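(* Let $X$ be a metrizable (real) locally convex space and let $C\subset X$ be a separable bounded set containing no $\ell_1$-sequence. Then the weak closure (in $X$) of the set $C-C=\{x-y\colon x,y\in C\}$ is Fréchet-Urysohn with respect to the weak topology.
   Context: Vector spaces are real. The weak topology is $\sigma(X,X^* )$. A topological space $S$ is Fréchet-Urysohn if whenever $A\subset S$ and $x\in\overline{A}$, there is a sequence $(x_n)$ in $A$ with $x_n\to x$. Let $\ell_1^0$ be the subspace of $\ell_1$ formed by elements with only finitely many nonzero coordinates, equipped with the $\ell_1$-norm. A sequence $(x_n)$ in a topological vector space $X$ is an $\ell_1$-sequence if the linear mapping $T_0\colon\ell_1^0\to X$, $T_0((a_i)_{i=1}^\infty)=\sum_{i=1}^\infty a_ix_i$, is an isomorphism (linear homeomorphism) of $\ell_1^0$ onto $T_0(\ell_1^0)$. A set contains no $\ell_1$-sequence if no sequence of its elements is an $\ell_1$-sequence. *)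

theory Defs
  imports "HOL-Analysis.Analysis"
begin

class topological_real_vector = real_vector + topological_ab_group_add +
  assumes tendsto_scaleR_Pair:
    "LIM p (nhds r \<times>\<^sub>F nhds x). fst p *\<^sub>R snd p :> nhds (r *\<^sub>R x)"

text \<open>
  Convexity of \<open>V\<close> is spelled out because the constant \<open>convex\<close> cannot be used inside the
  class specification; \<open>convex_base_at_0\<close> restates the axiom with \<open>convex\<close>.
\<close>
class locally_convex_space = topological_real_vector +
  assumes locally_convex:
    "open U \<Longrightarrow> 0 \<in> U \<Longrightarrow> \<exists>V. open V \<and> 0 \<in> V \<and> V \<subseteq> U \<and>
       (\<forall>x\<in>V. \<forall>y\<in>V. \<forall>u\<ge>0. \<forall>v\<ge>0. u + v = 1 \<longrightarrow> u *\<^sub>R x + v *\<^sub>R y \<in> V)"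

lemma convex_base_at_0:
  fixes U :: "'a::locally_convex_space set"
  assumes "open U" "0 \<in> U"
  shows "\<exists>V. open V \<and> 0 \<in> V \<and> V \<subseteq> U \<and> convex V"
  using locally_convex[OF assms] by (simp add: convex_def)

instance real_normed_vector < topological_real_vector
proof
  fix r :: real and x :: 'a
  show "LIM p (nhds r \<times>\<^sub>F nhds x). fst p *\<^sub>R snd p :> nhds (r *\<^sub>R x)"
    by (intro tendsto_scaleR filterlim_fst filterlim_snd)
qed

instance real_normed_vector < locally_convex_space
proof
  fix U :: "'a set"
  assume "open U" "0 \<in> U"
  then obtain e where "e > 0" "ball 0 e \<subseteq> U"
    by (meson open_contains_ball)
  then show "\<exists>V. open V \<and> 0 \<in> V \<and> V \<subseteq> U \<and>
       (\<forall>x\<in>V. \<forall>y\<in>V. \<forall>u\<ge>0. \<forall>v\<ge>0. u + v = 1 \<longrightarrow> u *\<^sub>R x + v *\<^sub>R y \<in> V)"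
    using convex_ball[of 0 e] by (intro exI[of _ "ball 0 e"]) (simp add: convex_def)
qed

text \<open>
  Boundedness in the sense of topological vector spaces. The library constant \<open>bounded\<close> refers
  to a fixed metric and is a different notion.
\<close>
definition tvs_bounded :: "'a::topological_real_vector set \<Rightarrow> bool" where
  "tvs_bounded C \<longleftrightarrow>
     (\<forall>U. open U \<and> 0 \<in> U \<longrightarrow> (\<exists>s>0. \<forall>t>s. C \<subseteq> (\<lambda>u. t *\<^sub>R u) ` U))"

definition topological_dual :: "('a::topological_real_vector \<Rightarrow> real) set" where
  "topological_dual = {f. linear f \<and> continuous_on UNIV f}"

definition weak_topology :: "'a::topological_real_vector topology" where
  "weak_topology = topology_generated_by {f -` U | f U. f \<in> topological_dual \<and> open U}"

definition frechet_urysohn_space :: "'a topology \<Rightarrow> bool" where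
  "frechet_urysohn_space S \<longleftrightarrow>
     (\<forall>A x. A \<subseteq> topspace S \<and> x \<in> S closure_of A \<longrightarrow>
        (\<exists>\<xi>::nat \<Rightarrow> 'a. range \<xi> \<subseteq> A \<and> limitin S \<xi> x sequentially))"

definition l10 :: "(nat \<Rightarrow> real) set" where
  "l10 = {a. finite {i. a i \<noteq> 0}}"

definition l1_norm :: "(nat \<Rightarrow> real) \<Rightarrow> real" where
  "l1_norm a = (\<Sum>i | a i \<noteq> 0. \<bar>a i\<bar>)"

definition l1_dist :: "(nat \<Rightarrow> real) \<Rightarrow> (nat \<Rightarrow> real) \<Rightarrow> real" where
  "l1_dist a b = l1_norm (\<lambda>i. a i - b i)"

text \<open>
  The norm topology on \<open>l10\<close> has to be given explicitly: the type class topology on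
  \<^typ>\<open>nat \<Rightarrow> real\<close> is that of pointwise convergence.
\<close>
definition l10_topology :: "(nat \<Rightarrow> real) topology" where
  "l10_topology = Metric_space.mtopology l10 l1_dist"

definition T0 :: "(nat \<Rightarrow> 'a::real_vector) \<Rightarrow> (nat \<Rightarrow> real) \<Rightarrow> 'a" where
  "T0 x a = (\<Sum>i | a i \<noteq> 0. a i *\<^sub>R x i)"

text \<open>
  \<open>T0 x\<close> is linear on \<open>l10\<close> (see \<open>T0_add\<close>, \<open>T0_scale\<close>), so
  being an isomorphism onto its range only requires it to be a homeomorphism.
\<close>
definition l1_sequence :: "(nat \<Rightarrow> 'a::topological_real_vector) \<Rightarrow> bool" where
  "l1_sequence x \<longleftrightarrow>
     homeomorphic_map l10_topology (top_of_set (T0 x ` l10)) (T0 x)"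

lemma T0_eq_sum:
  assumes "finite I" "{i. a i \<noteq> 0} \<subseteq> I"
  shows "T0 x a = (\<Sum>i\<in>I. a i *\<^sub>R x i)"
  unfolding T0_def by (rule sum.mono_neutral_left) (use assms in auto)

lemma T0_add:
  assumes "a \<in> l10" "b \<in> l10"
  shows "T0 x (\<lambda>i. a i + b i) = T0 x a + T0 x b"
proof -
  let ?I = "{i. a i \<noteq> 0} \<union> {i. b i \<noteq> 0}"
  have I: "finite ?I"
    using assms by (simp add: l10_def)
  have "T0 x (\<lambda>i. a i + b i) = (\<Sum>i\<in>?I. (a i + b i) *\<^sub>R x i)"
    by (rule T0_eq_sum[OF I]) auto
  also have "\<dots> = (\<Sum>i\<in>?I. a i *\<^sub>R x i) + (\<Sum>i\<in>?I. b i *\<^sub>R x i)"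
    by (simp add: scaleR_add_left sum.distrib)
  also have "(\<Sum>i\<in>?I. a i *\<^sub>R x i) = T0 x a"
    by (rule T0_eq_sum[OF I, symmetric]) auto
  also have "(\<Sum>i\<in>?I. b i *\<^sub>R x i) = T0 x b"
    by (rule T0_eq_sum[OF I, symmetric]) auto
  finally show ?thesis .
qed

lemma T0_scale:
  assumes "a \<in> l10"
  shows "T0 x (\<lambda>i. c * a i) = c *\<^sub>R T0 x a"
proof -
  have "T0 x (\<lambda>i. c * a i) = (\<Sum>i | a i \<noteq> 0. (c * a i) *\<^sub>R x i)"
    by (rule T0_eq_sum) (use assms in \<open>auto simp: l10_def\<close>)
  then show ?thesis
    by (simp add: T0_def scaleR_sum_right)
qed

lemma l1_norm_eq_sum:
  assumes "finite I" "{i. a i \<noteq> 0} \<subseteq> I"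
  shows "l1_norm a = (\<Sum>i\<in>I. \<bar>a i\<bar>)"
  unfolding l1_norm_def by (rule sum.mono_neutral_left) (use assms in auto)

lemma Metric_space_l10: "Metric_space l10 l1_dist"
proof
  fix a b :: "nat \<Rightarrow> real"
  show "0 \<le> l1_dist a b"
    by (simp add: l1_dist_def l1_norm_def sum_nonneg)
  show "l1_dist a b = l1_dist b a"
    by (auto simp: l1_dist_def l1_norm_def abs_minus_commute intro!: sum.cong)
next
  fix a b :: "nat \<Rightarrow> real"
  assume "a \<in> l10" "b \<in> l10"
  then have I: "finite ({i. a i \<noteq> 0} \<union> {i. b i \<noteq> 0})" (is "finite ?I")
    by (simp add: l10_def)
  have dist: "l1_dist a b = (\<Sum>i\<in>?I. \<bar>a i - b i\<bar>)"
    unfolding l1_dist_def by (rule l1_norm_eq_sum[OF I]) auto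
  show "l1_dist a b = 0 \<longleftrightarrow> a = b"
  proof
    assume "l1_dist a b = 0"
    then have "(\<Sum>i\<in>?I. \<bar>a i - b i\<bar>) = 0"
      using dist by metis
    then have eq: "\<forall>i\<in>?I. \<bar>a i - b i\<bar> = 0"
      by (rule sum_nonneg_eq_0_iff[OF I abs_ge_zero, THEN iffD1])
    show "a = b"
    proof
      fix i
      show "a i = b i"
      proof (cases "a i = 0 \<and> b i = 0")
        case False
        then have "i \<in> ?I"
          by blast
        with eq have "\<bar>a i - b i\<bar> = 0"
          by (rule bspec)
        then show ?thesis
          by simp
      qed simp
    qed
  next
    assume "a = b"
    then show "l1_dist a b = 0"
      by (simp add: l1_dist_def l1_norm_def)
  qed
next
  fix a b c :: "nat \<Rightarrow> real"
  assume "a \<in> l10" "b \<in> l10" "c \<in> l10"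
  then have I: "finite ({i. a i \<noteq> 0} \<union> {i. b i \<noteq> 0} \<union> {i. c i \<noteq> 0})" (is "finite ?I")
    by (simp add: l10_def)
  have "l1_dist a c = (\<Sum>i\<in>?I. \<bar>a i - c i\<bar>)"
    unfolding l1_dist_def by (rule l1_norm_eq_sum[OF I]) auto
  also have "\<dots> \<le> (\<Sum>i\<in>?I. \<bar>a i - b i\<bar> + \<bar>b i - c i\<bar>)"
    by (rule sum_mono) simp
  also have "\<dots> = (\<Sum>i\<in>?I. \<bar>a i - b i\<bar>) + (\<Sum>i\<in>?I. \<bar>b i - c i\<bar>)"
    by (rule sum.distrib)
  also have "(\<Sum>i\<in>?I. \<bar>a i - b i\<bar>) = l1_dist a b"
    unfolding l1_dist_def by (rule l1_norm_eq_sum[OF I, symmetric]) auto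
  also have "(\<Sum>i\<in>?I. \<bar>b i - c i\<bar>) = l1_dist b c"
    unfolding l1_dist_def by (rule l1_norm_eq_sum[OF I, symmetric]) auto
  finally show "l1_dist a c \<le> l1_dist a b + l1_dist b c" .
qed

lemma topspace_weak_topology: "topspace weak_topology = UNIV"
proof -
  have "(\<lambda>_. 0) \<in> topological_dual"
    by (simp add: topological_dual_def linear_iff)
  then have "(\<lambda>_. 0) -` (UNIV :: real set) \<in> {f -` U | f U. f \<in> topological_dual \<and> open U}"
    by blast
  then have "(\<lambda>_. 0) -` (UNIV :: real set) \<subseteq> topspace weak_topology"
    unfolding weak_topology_def topology_generated_by_topspace by (rule Union_upper)
  then show ?thesis
    unfolding vimage_UNIV by (rule top.extremum_uniqueI)
qed

end

theory Submission
  imports Defs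
begin

text \<open>
  The dual \<open>X\<^sup>*\<close> is a countable union of compact polars \<open>K\<close> of neighbourhoods of \<open>0\<close>, so \<open>X\<close> has
  countable weak tightness, and it suffices to extract a weakly convergent sequence from a sequence
  \<open>(a\<^sub>n)\<close> in the weak closure \<open>D\<close> of \<open>C - C\<close> that tends weakly to \<open>x\<close> along an ultrafilter \<open>U\<close>.
  Closed games whose moves come from sets of \<open>U\<close> are determined. If no suitable subsequence exists,
  the strategies obtained on some \<open>K\<close> produce a subsequence of \<open>(a\<^sub>n - x)\<close> whose values realise on
  \<open>K\<close> all patterns of large and small. The ultralimit of the averages over the points realising
  these patterns is a finitely additive mean for which the subsequence is separated in the
  \<open>L\<^sub>1\<close>-seminorm. On the other hand, by Rosenthal's dichotomy (another instance of the game) and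
  bounded convergence, \<open>C\<close> is totally bounded in this seminorm, and so is \<open>D\<close> because the balls of
  the seminorm are weakly closed: a contradiction.
\<close>

section \<open>Strategies in an ultrafilter\<close>

text \<open>Rosenthal's dichotomy controls sequences in \<open>C\<close>, but a point of
  \<open>D\<close> is only the limit of a net, so the absence of independent sequences does not pass
  to \<open>D\<close> term by term. Total boundedness in a seminorm that is a supremum of weakly
  continuous functionals does pass to weak closures; hence the detour through a mean. That mean has
  to act on discontinuous bounded functions (indicators, signs), and compactness of \<open>K\<close>
  replaces countable additivity. The other obstacle is uniformity: the sequence has to tend to
  \<open>x\<close> at uncountably many functionals, while \<open>U\<close> is arbitrary and need not
  contain one set that serves all of them. A strategy, which prescribes a new set of
  \<open>U\<close> after every finite history, is the substitute. Only countably many strategies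
  have to be combined, one for each polar of a countable base (in Rosenthal's dichotomy, one for
  each pair of rationals), and a diagonal sequence can respect all of them.\<close>

definition ultrafilter :: "'a filter \<Rightarrow> bool" where
  "ultrafilter U \<longleftrightarrow> U \<noteq> bot \<and> (\<forall>P. eventually P U \<or> eventually (\<lambda>x. \<not> P x) U)"

lemma ultrafilter_exists:
  assumes "F \<noteq> bot"
  shows "\<exists>U. U \<le> F \<and> ultrafilter U"
proof -
  define A where "A = {G. G \<noteq> bot \<and> G \<le> F}"
  define R where "R = relation_of (\<lambda>G H :: 'a filter. H \<le> G) A"
  have "\<exists>m\<in>A. \<forall>a\<in>A. a \<le> m \<longrightarrow> a = m"
  proof (rule predicate_Zorn)
    show "partial_order_on A (relation_of (\<lambda>G H. H \<le> G) A)"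
      by (rule partial_order_on_relation_ofI) auto
  next
    fix C assume C: "C \<in> Chains (relation_of (\<lambda>G H. H \<le> G) A)"
    have CA: "C \<subseteq> A" and tot: "\<And>G H. G \<in> C \<Longrightarrow> H \<in> C \<Longrightarrow> G \<le> H \<or> H \<le> G"
      using C by (auto simp: Chains_def relation_of_def)
    show "\<exists>u\<in>A. \<forall>a\<in>C. u \<le> a"
    proof (cases "C = {}")
      case True
      with assms show ?thesis by (auto simp: A_def)
    next
      case False
      have dir: "\<exists>x\<in>C. x \<le> inf G H" if "G \<in> C" "H \<in> C" for G H
        using tot[OF that] that by (metis inf.absorb1 inf.absorb2 order_refl)
      have "Inf C \<noteq> bot"
      proof
        assume "Inf C = bot"
        then have "eventually (\<lambda>_. False) (Inf C)" by simp
        then have "\<exists>G\<in>C. eventually (\<lambda>_. False) G"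
          using eventually_Inf_base[OF False dir] by blast
        with CA show False
          by (auto simp: A_def trivial_limit_def)
      qed
      moreover have "Inf C \<le> F"
        using False CA by (auto simp: A_def intro: Inf_lower2)
      ultimately show ?thesis
        by (auto simp: A_def intro!: bexI[of _ "Inf C"] Inf_lower)
    qed
  qed
  then obtain U where U: "U \<in> A" and max: "\<And>G. G \<in> A \<Longrightarrow> G \<le> U \<Longrightarrow> G = U" by blast
  have "eventually P U \<or> eventually (\<lambda>x. \<not> P x) U" for P
  proof (rule disjCI)
    assume n: "\<not> eventually (\<lambda>x. \<not> P x) U"
    let ?G = "inf U (principal {x. P x})"
    have "?G \<noteq> bot"
      using n by (simp add: trivial_limit_def eventually_inf_principal)
    moreover have "?G \<le> F"
      using U by (auto simp: A_def intro: le_infI1)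
    ultimately have "?G = U"
      using max[of ?G] by (simp add: A_def)
    moreover have "eventually P ?G"
      by (simp add: eventually_inf_principal)
    ultimately show "eventually P U" by simp
  qed
  with U show ?thesis
    by (auto simp: A_def ultrafilter_def)
qed

lemma ultrafilter_tendsto:
  fixes h :: "'a \<Rightarrow> real"
  assumes U: "ultrafilter U" and b: "\<forall>\<^sub>F n in U. \<bar>h n\<bar> \<le> B"
  shows "\<exists>l. (h \<longlongrightarrow> l) U"
proof -
  have "eventually (\<lambda>y. y \<in> {-B..B}) (filtermap h U)"
    using b unfolding eventually_filtermap by (rule eventually_mono) (simp add: abs_le_iff)
  moreover have "filtermap h U \<noteq> bot"
    using U by (simp add: ultrafilter_def filtermap_bot_iff)
  moreover have "compact {-B..B}" by (rule compact_Icc)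
  ultimately obtain l where l: "inf (nhds l) (filtermap h U) \<noteq> bot"
    unfolding compact_filter by blast
  have "(h \<longlongrightarrow> l) U"
  proof (rule topological_tendstoI)
    fix S :: "real set" assume S: "open S" "l \<in> S"
    show "\<forall>\<^sub>F x in U. h x \<in> S"
    proof (rule ccontr)
      assume "\<not> ?thesis"
      then have "\<forall>\<^sub>F x in U. h x \<notin> S"
        using U by (auto simp: ultrafilter_def)
      then have "\<forall>\<^sub>F y in filtermap h U. y \<notin> S"
        by (simp add: eventually_filtermap)
      moreover have "\<forall>\<^sub>F y in nhds l. y \<in> S"
        using S by (rule eventually_nhds_in_open)
      ultimately have "\<forall>\<^sub>F y in inf (nhds l) (filtermap h U). False"
        unfolding eventually_inf by blast
      with l show False by (simp add: trivial_limit_def)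
    qed
  qed
  then show ?thesis ..
qed

section \<open>Closed games with moves from an ultrafilter\<close>

text \<open>The list is the history of moves, and \<open>S u\<close> is the set of moves allowed
  after it. A large set is offered after every list, even one that \<open>S\<close> itself would
  never produce; this makes it easy to combine strategies.\<close>

definition strategy :: "nat filter \<Rightarrow> (nat list \<Rightarrow> nat \<Rightarrow> bool) \<Rightarrow> bool" where
  "strategy U S \<longleftrightarrow> (\<forall>u. eventually (S u) U)"

definition follows :: "(nat list \<Rightarrow> nat \<Rightarrow> bool) \<Rightarrow> (nat \<Rightarrow> nat) \<Rightarrow> bool" where
  "follows S M \<longleftrightarrow> (\<forall>k. S (map M [0..<k]) (M k))"

text \<open>The positions from which leaving \<open>R\<close> can be forced. The least fixed point
  stands for the ordinal ranks of the open game.\<close>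

inductive bad :: "nat filter \<Rightarrow> (nat list \<Rightarrow> bool) \<Rightarrow> nat list \<Rightarrow> bool" for U R where
  bad_now: "\<not> R u \<Longrightarrow> bad U R u"
| bad_later: "eventually Q U \<Longrightarrow> (\<And>n. Q n \<Longrightarrow> bad U R (u @ [n])) \<Longrightarrow> bad U R u"

lemma map_upt_Suc_shift: "map M [0..<Suc k] = M 0 # map (M \<circ> Suc) [0..<k]"
  by (simp add: upt_conv_Cons map_Suc_upt[symmetric] del: upt_Suc)

lemma bad_strategy:
  assumes "bad U R u"
  shows "\<exists>S. strategy U S \<and> (\<forall>M. follows S M \<longrightarrow> (\<exists>k. \<not> R (u @ map M [0..<k])))"
  using assms
proof induction
  case (bad_now u)
  then show ?case
    by (intro exI[of _ "\<lambda>_ _. True"]) (auto simp: strategy_def intro!: exI[of _ 0])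
next
  case (bad_later Q u)
  then obtain T where T: "\<And>n. Q n \<Longrightarrow> strategy U (T n)"
      "\<And>n M. Q n \<Longrightarrow> follows (T n) M \<Longrightarrow> \<exists>k. \<not> R ((u @ [n]) @ map M [0..<k])"
    by metis
  \<comment> \<open>The guard \<open>Q n\<close> makes \<open>S\<close> permissive after a first
    move outside \<open>Q\<close>, where \<open>T n\<close> need not be a strategy.\<close>
  define S where "S v = (case v of [] \<Rightarrow> Q | n # w \<Rightarrow> (\<lambda>m. Q n \<longrightarrow> T n w m))" for v
  have "strategy U S"
    unfolding strategy_def
  proof
    fix v show "eventually (S v) U"
      using T(1) bad_later.hyps(1)
      by (cases v) (auto simp: S_def strategy_def)
  qed
  moreover have "\<exists>k. \<not> R (u @ map M [0..<k])" if M: "follows S M" for M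
  proof -
    have Q: "Q (M 0)"
      using M[unfolded follows_def, rule_format, of 0] by (simp add: S_def)
    have "follows (T (M 0)) (M \<circ> Suc)"
      unfolding follows_def
    proof
      fix k
      show "T (M 0) (map (M \<circ> Suc) [0..<k]) ((M \<circ> Suc) k)"
        using M[unfolded follows_def, rule_format, of "Suc k"] Q
        unfolding map_upt_Suc_shift S_def by simp
    qed
    from T(2)[OF Q this] obtain k where "\<not> R ((u @ [M 0]) @ map (M \<circ> Suc) [0..<k])" ..
    then have "\<not> R (u @ map M [0..<Suc k])"
      unfolding map_upt_Suc_shift by simp
    then show ?thesis ..
  qed
  ultimately show ?case by blast
qed

text \<open>Determinacy usually gives a strategy to one of two opponents. Here both alternatives are
  strategies of the same player: if a position is not bad, its bad successors are not
  \<open>U\<close>-many, so by the ultrafilter property \<open>U\<close>-many successors are not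
  bad.\<close>

lemma strategy_dichotomy:
  assumes "ultrafilter U"
  obtains (keep) S where "strategy U S" "\<And>M k. follows S M \<Longrightarrow> R (map M [0..<k])"
  | (break) S where "strategy U S" "\<And>M. follows S M \<Longrightarrow> \<exists>k. \<not> R (map M [0..<k])"
proof (cases "bad U R []")
  case True
  from bad_strategy[OF this] show ?thesis using break by auto
next
  case False
  define S where "S = (\<lambda>u n. bad U R u \<or> \<not> bad U R (u @ [n]))"
  have "strategy U S"
    unfolding strategy_def
  proof
    fix u
    show "eventually (S u) U"
    proof (cases "bad U R u")
      case False
      then have "\<not> (\<forall>\<^sub>F n in U. bad U R (u @ [n]))"
        using bad_later by blast
      with assms have "\<forall>\<^sub>F n in U. \<not> bad U R (u @ [n])"
        unfolding ultrafilter_def by blast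
      then show ?thesis
        by (rule eventually_mono) (simp add: S_def)
    qed (simp add: S_def)
  qed
  moreover have "R (map M [0..<k])" if "follows S M" for M k
  proof -
    have "\<not> bad U R (map M [0..<k])"
    proof (induction k)
      case (Suc k)
      with that[unfolded follows_def S_def, rule_format, of k] show ?case by simp
    qed (simp add: False)
    then show ?thesis using bad_now by blast
  qed
  ultimately show ?thesis using keep by blast
qed

lemma course_of_values_sequence: "\<exists>M :: nat \<Rightarrow> 'a. \<forall>k. M k = c (map M [0..<k])"
proof -
  define L where "L = rec_nat [] (\<lambda>_ l. l @ [c l])"
  have "L k = map (\<lambda>i. c (L i)) [0..<k]" for k
    by (induction k) (simp_all add: L_def)
  then show ?thesis
    by (intro exI[of _ "\<lambda>i. c (L i)"]) metis
qed

lemma strategy_followed: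
  assumes "strategy U S" "U \<noteq> bot"
  shows "\<exists>M. follows S M"
proof -
  have "\<exists>n. S u n" for u
    using assms by (auto simp: strategy_def intro: eventually_happens')
  then obtain c where "\<And>u. S u (c u)" by metis
  with course_of_values_sequence[of c] show ?thesis
    unfolding follows_def by metis
qed

text \<open>Diagonal intersection: after the history \<open>l\<close> a move has to be allowed by
  the strategies up to index \<open>length l\<close>, after every list of at most
  \<open>length l\<close> entries from \<open>l\<close>. These are finitely many conditions, and
  they cover the histories of all subsequences. With \<open>q \<le> g 0\<close>, the strategy
  \<open>S q\<close> is already respected at the first move of the subsequence.\<close>

lemma strategies_diagonal:
  fixes S :: "nat \<Rightarrow> nat list \<Rightarrow> nat \<Rightarrow> bool"
  assumes S: "\<And>q. strategy U (S q)" and "U \<noteq> bot"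
  obtains M where "\<And>q g. strict_mono g \<Longrightarrow> q \<le> g 0 \<Longrightarrow> follows (S q) (M \<circ> g)"
proof -
  define T where "T l n \<longleftrightarrow> (\<forall>q\<in>{..length l}. \<forall>u\<in>{u. set u \<subseteq> set l \<and> length u \<le> length l}. S q u n)"
    for l n
  have "strategy U T"
    unfolding strategy_def T_def using S
    by (intro allI eventually_ball_finite ballI finite_lists_length_le)
      (auto simp: strategy_def)
  then obtain M where M: "follows T M"
    using strategy_followed assms by blast
  have "follows (S q) (M \<circ> g)" if g: "strict_mono g" "q \<le> g 0" for q g
    unfolding follows_def
  proof
    fix k
    have "T (map M [0..<g k]) (M (g k))"
      using M by (simp add: follows_def)
    moreover have "q \<le> g k"
      using g strict_mono_less_eq[of g 0 k] by simp
    moreover have "k \<le> g k"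
      using g(1) by (rule strict_mono_imp_increasing)
    moreover have "g i < g k" if "i < k" for i
      using g(1) that by (rule strict_monoD)
    ultimately show "S q (map (M \<circ> g) [0..<k]) ((M \<circ> g) k)"
      unfolding T_def by (elim ballE[of _ _ q] ballE[of _ _ "map (M \<circ> g) [0..<k]"]) auto
  qed
  then show ?thesis by (rule that)
qed

section \<open>Independent sequences of functions\<close>

definition alternating :: "'t set \<Rightarrow> (nat \<Rightarrow> 't \<Rightarrow> bool) \<Rightarrow> (nat \<Rightarrow> 't \<Rightarrow> bool) \<Rightarrow> nat list \<Rightarrow> bool" where
  "alternating K B L u \<longleftrightarrow>
     (\<exists>t\<in>K. \<forall>i<length u. if even i then B (u ! i) t else L (u ! i) t)"

definition independent_on :: "'t set \<Rightarrow> (nat \<Rightarrow> 't \<Rightarrow> bool) \<Rightarrow> (nat \<Rightarrow> 't \<Rightarrow> bool) \<Rightarrow> bool" where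
  "independent_on K B L \<longleftrightarrow>
     (\<forall>N P. \<exists>t\<in>K. \<forall>i<N. if i \<in> P then B i t else L i t)"

text \<open>From each block \<open>3 * i\<close>, \<open>3 * i + 1\<close>, \<open>3 * i + 2\<close>
  the subsequence takes the last two indices if \<open>i \<in> P\<close> and the first two
  otherwise. The middle index then falls on an even position (\<open>B\<close>) or an odd one
  (\<open>L\<close>), so alternation along all subsequences yields every pattern on the middle
  indices.\<close>

lemma alternating_imp_independent:
  assumes "\<And>g k. strict_mono g \<Longrightarrow> alternating K B L (map (M \<circ> g) [0..<k])"
  shows "independent_on K (\<lambda>i. B (M (3 * i + 1))) (\<lambda>i. L (M (3 * i + 1)))"
  unfolding independent_on_def
proof (intro allI)
  fix N :: nat and P :: "nat set"
  define g where "g j = 3 * (j div 2) + (if j div 2 \<in> P then 1 else 0) + j mod 2" for j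
  have "strict_mono g"
    unfolding strict_mono_Suc_iff
  proof
    fix j
    show "g j < g (Suc j)"
    proof (cases "even j")
      case True
      then obtain i where "j = 2 * i" by blast
      then show ?thesis by (simp add: g_def)
    next
      case False
      then obtain i where "j = 2 * i + 1" using oddE by blast
      then show ?thesis by (simp add: g_def)
    qed
  qed
  from assms[OF this, of "2 * N"] obtain t where t: "t \<in> K"
    "\<forall>j<2 * N. if even j then B (map (M \<circ> g) [0..<2 * N] ! j) t else L (map (M \<circ> g) [0..<2 * N] ! j) t"
    by (auto simp: alternating_def simp del: upt_Suc)
  then have t2: "if even j then B (M (g j)) t else L (M (g j)) t" if "j < 2 * N" for j
    using that by (elim allE[of _ j]) (simp split: if_splits)
  have "if i \<in> P then B (M (3 * i + 1)) t else L (M (3 * i + 1)) t" if "i < N" for i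
    using t2[of "2 * i"] t2[of "2 * i + 1"] that by (auto simp: g_def)
  with t(1) show "\<exists>t\<in>K. \<forall>i<N. if i \<in> P then B (M (3 * i + 1)) t else L (M (3 * i + 1)) t"
    by blast
qed

text \<open>If alternation can be kept up by a strategy, diagonalising this strategy with itself
  gives a sequence all of whose subsequences are plays of it.\<close>

lemma independent_or_strategy:
  assumes "ultrafilter U"
  obtains (independent) e where "independent_on K (\<lambda>i. B (e i)) (\<lambda>i. L (e i))"
  | (strategy) S where "strategy U S"
      "\<And>M. follows S M \<Longrightarrow> \<exists>k. \<not> alternating K B L (map M [0..<k])"
  using assms
proof (cases rule: strategy_dichotomy[where R = "alternating K B L"])
  case (keep S)
  obtain M :: "nat \<Rightarrow> nat" where "\<And>g :: nat \<Rightarrow> nat. strict_mono g \<Longrightarrow> follows S (M \<circ> g)"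
    using strategies_diagonal[of U "\<lambda>_. S"] keep(1) assms unfolding ultrafilter_def
    by (metis le0)
  then have "independent_on K (\<lambda>i. B (M (3 * i + 1))) (\<lambda>i. L (M (3 * i + 1)))"
    by (rule alternating_imp_independent[OF keep(2)])
  then show ?thesis by (rule independent)
next
  case (break S)
  then show ?thesis by (rule strategy)
qed

text \<open>The bound \<open>q\<close> lets the subsequence start late enough to be a play of the
  strategy with index \<open>q\<close> in \<open>strategies_diagonal\<close>.\<close>

lemma alternating_subsequence:
  assumes "\<exists>\<^sub>\<infinity>n. B n" "\<exists>\<^sub>\<infinity>n. L n"
  shows "\<exists>g :: nat \<Rightarrow> nat. strict_mono g \<and> q \<le> g 0 \<and> (\<forall>i. if even i then B (g i) else L (g i))"
proof -
  have "\<exists>g. \<forall>i. (q \<le> g i \<and> (if even i then B (g i) else L (g i))) \<and> g i < g (Suc i)"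
  proof (rule dependent_nat_choice)
    show "\<exists>x. q \<le> x \<and> (if even (0::nat) then B x else L x)"
      using assms(1) by (auto simp: INFM_nat_le)
    fix x n :: nat
    show "\<exists>y. (q \<le> y \<and> (if even (Suc n) then B y else L y)) \<and> x < y"
      using assms unfolding INFM_nat_le
      by (metis Suc_le_eq max.bounded_iff)
  qed
  then show ?thesis by (auto simp: strict_mono_Suc_iff)
qed

section \<open>Rosenthal's dichotomy for pointwise bounded sequences\<close>

text \<open>The levels are rational because each pair of levels will have its own strategy, and only
  countably many strategies can be diagonalised.\<close>

lemma bounded_not_convergent_oscillates:
  fixes X :: "nat \<Rightarrow> real"
  assumes b: "\<And>n. \<bar>X n\<bar> \<le> b" and nc: "\<not> convergent X"
  obtains r s :: rat where "r < s" "\<exists>\<^sub>\<infinity>n. X n \<ge> of_rat s" "\<exists>\<^sub>\<infinity>n. X n \<le> of_rat r"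
proof -
  have "bounded (range X)"
    using b by (auto simp: bounded_iff)
  then obtain l \<rho> where \<rho>: "strict_mono \<rho>" and l: "(X \<circ> \<rho>) \<longlonglongrightarrow> l"
    using bounded_imp_convergent_subsequence by blast
  have near: "\<exists>\<^sub>\<infinity>n. \<bar>X n - l\<bar> < e" if "e > 0" for e
    unfolding INFM_nat_le
  proof
    fix m
    obtain N where N: "\<And>n. n \<ge> N \<Longrightarrow> \<bar>X (\<rho> n) - l\<bar> < e"
      using LIMSEQ_D[OF l \<open>e > 0\<close>] by auto
    show "\<exists>n\<ge>m. \<bar>X n - l\<bar> < e"
      using N[of "max m N"] strict_mono_imp_increasing[OF \<rho>, of "max m N"]
      by (intro exI[of _ "\<rho> (max m N)"]) auto
  qed
  have "\<not> X \<longlonglongrightarrow> l" using nc by (auto simp: convergent_def)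
  then obtain e where e: "e > 0" "\<exists>\<^sub>\<infinity>n. \<bar>X n - l\<bar> \<ge> e"
    unfolding LIMSEQ_iff INFM_nat_le real_norm_def by (metis not_less)
  have "\<exists>\<^sub>\<infinity>n. X n \<ge> l + e \<or> X n \<le> l - e"
    using e(2) by (rule INFM_mono) linarith
  then consider "\<exists>\<^sub>\<infinity>n. X n \<ge> l + e" | "\<exists>\<^sub>\<infinity>n. X n \<le> l - e"
    unfolding INFM_disj_distrib by blast
  then show ?thesis
  proof cases
    case 1
    obtain r where r: "l < of_rat r" "of_rat r < l + e"
      using of_rat_dense[of l "l + e"] e by auto
    obtain s where s: "of_rat r < (of_rat s :: real)" "of_rat s < l + e"
      using of_rat_dense[of "of_rat r" "l + e"] r by auto
    have "\<exists>\<^sub>\<infinity>n. X n \<ge> of_rat s" using 1 by (rule INFM_mono) (use s in simp)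
    moreover have "\<exists>\<^sub>\<infinity>n. X n \<le> of_rat r"
      using near[of "of_rat r - l"] r by (auto elim!: INFM_mono)
    ultimately show ?thesis using that s by (simp add: of_rat_less)
  next
    case 2
    obtain s where s: "l - e < of_rat s" "of_rat s < l"
      using of_rat_dense[of "l - e" l] e by auto
    obtain r where r: "l - e < of_rat r" "of_rat r < (of_rat s :: real)"
      using of_rat_dense[of "l - e" "of_rat s"] s by auto
    have "\<exists>\<^sub>\<infinity>n. X n \<le> of_rat r" using 2 by (rule INFM_mono) (use r in simp)
    moreover have "\<exists>\<^sub>\<infinity>n. X n \<ge> of_rat s"
      using near[of "l - of_rat s"] s by (auto elim!: INFM_mono)
    ultimately show ?thesis using that r by (simp add: of_rat_less)
  qed
qed

text \<open>Without an independent sequence, every rational pair \<open>r < s\<close> has a strategy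
  that stops alternation between the two levels. At a point where the diagonal sequence diverges, it
  oscillates between such a pair, so some late subsequence alternates forever although it is a play
  of the strategy of that pair.\<close>

theorem rosenthal_dichotomy:
  fixes y :: "nat \<Rightarrow> 't \<Rightarrow> real"
  assumes bdd: "\<And>t. t \<in> K \<Longrightarrow> \<exists>b. \<forall>n. \<bar>y n t\<bar> \<le> b"
  obtains (independent) e r s where "r < s" "independent_on K (\<lambda>i t. y (e i) t \<ge> s) (\<lambda>i t. y (e i) t \<le> r)"
  | (convergent) g where "strict_mono g" "\<And>t. t \<in> K \<Longrightarrow> convergent (\<lambda>n. y (g n) t)"
proof -
  obtain U :: "nat filter" where U: "U \<le> sequentially" "ultrafilter U"
    using ultrafilter_exists[of sequentially] by auto
  define alt where "alt = (\<lambda>(r::rat, s::rat).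
    alternating K (\<lambda>i t. y i t \<ge> of_rat s) (\<lambda>i t. y i t \<le> of_rat r))"
  show thesis
  proof (cases "\<exists>e r s. r < s \<and> independent_on K (\<lambda>i t. y (e i) t \<ge> s) (\<lambda>i t. y (e i) t \<le> r)")
    case True
    then show ?thesis using independent by blast
  next
    case False
    have "\<exists>S. strategy U S \<and> (\<forall>M. follows S M \<longrightarrow> (\<exists>k. \<not> alt p (map M [0..<k])))"
      if "fst p < snd p" for p
      using U(2)
    proof (cases rule: independent_or_strategy[where K = K and
          B = "\<lambda>i t. y i t \<ge> of_rat (snd p)" and L = "\<lambda>i t. y i t \<le> of_rat (fst p)"])
      case (independent e)
      then show ?thesis using False that by (auto simp: of_rat_less)
    next
      case (strategy S)
      then show ?thesis by (auto simp: alt_def case_prod_beta)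
    qed
    then obtain S where S: "\<And>p. fst p < snd p \<Longrightarrow> strategy U (S p)"
      "\<And>p M. fst p < snd p \<Longrightarrow> follows (S p) M \<Longrightarrow> \<exists>k. \<not> alt p (map M [0..<k])"
      by metis
    \<comment> \<open>Strategy \<open>0\<close> makes \<open>M\<close> increasing. The pair with
      code \<open>q\<close> gets the index \<open>Suc q\<close>, and codes of pairs that are not
      ordered impose no restriction.\<close>
    define T where "T q = (case q of
        0 \<Rightarrow> (\<lambda>u n. \<forall>i\<in>set u. i < n)
      | Suc q \<Rightarrow> (let p = from_nat q in if fst p < snd p then S p else (\<lambda>_ _. True)))" for q
    have ev: "\<forall>\<^sub>F n in U. \<forall>i\<in>set u. i < n" for u
      using U(1) by (rule filter_leD) (simp add: eventually_ball_finite eventually_gt_at_top)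
    have "strategy U (T q)" for q
      using S(1) ev by (cases q) (auto simp: T_def Let_def strategy_def)
    then obtain M where M: "\<And>q (g :: nat \<Rightarrow> nat). strict_mono g \<Longrightarrow> q \<le> g 0 \<Longrightarrow> follows (T q) (M \<circ> g)"
      using strategies_diagonal[of U T] U(2) unfolding ultrafilter_def by metis
    have "follows (T 0) M"
      using M[of id 0] by (simp add: strict_mono_id)
    then have "strict_mono M"
      by (auto simp: follows_def T_def strict_mono_def)
    moreover have "convergent (\<lambda>n. y (M n) t)" if t: "t \<in> K" for t
    proof (rule ccontr)
      assume nc: "\<not> ?thesis"
      obtain b where b: "\<And>n. \<bar>y (M n) t\<bar> \<le> b" using bdd[OF t] by blast
      obtain r s where rs: "r < s" "\<exists>\<^sub>\<infinity>n. y (M n) t \<ge> of_rat s" "\<exists>\<^sub>\<infinity>n. y (M n) t \<le> of_rat r"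
        using bounded_not_convergent_oscillates[OF b nc] by blast
      define q where "q = to_nat (r, s)"
      obtain g :: "nat \<Rightarrow> nat" where g: "strict_mono g" "Suc q \<le> g 0"
        "\<forall>i. if even i then y (M (g i)) t \<ge> of_rat s else y (M (g i)) t \<le> of_rat r"
        using alternating_subsequence[OF rs(2,3), of "Suc q"] by (elim exE conjE)
      have "follows (S (r, s)) (M \<circ> g)"
        using M[OF g(1,2)] rs(1) by (simp add: T_def q_def)
      then obtain k where "\<not> alt (r, s) (map (M \<circ> g) [0..<k])"
        using S(2)[of "(r, s)"] rs(1) by auto
      moreover have "alt (r, s) (map (M \<circ> g) [0..<k])"
        unfolding alt_def alternating_def prod.case
        using g(3) by (intro bexI[OF _ t] allI impI) (simp split: if_splits)
      ultimately show False by contradiction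
    qed
    ultimately show ?thesis by (rule convergent)
  qed
qed

section \<open>Forcing small values on a compact set\<close>

lemma compact_fip_sequence:
  fixes K :: "'t::topological_space set" and F :: "nat \<Rightarrow> 't set"
  assumes "compact K" "\<And>n. closed (F n)" "\<And>n. \<exists>t\<in>K. \<forall>k<n. t \<in> F k"
  shows "\<exists>t\<in>K. \<forall>n. t \<in> F n"
proof -
  have "K \<inter> (\<Inter>n\<in>UNIV. F n) \<noteq> {}"
  proof (rule compact_imp_fip_image[OF assms(1,2)])
    fix I' :: "nat set" assume "finite I'"
    then obtain n where "\<forall>i\<in>I'. i < n" using finite_nat_set_iff_bounded by blast
    then show "K \<inter> (\<Inter>i\<in>I'. F i) \<noteq> {}" using assms(3)[of n] by blast
  qed
  then show ?thesis by auto
qed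

text \<open>
  Suppose that on the contrary some strategy \<open>S\<close> forces \<open>a (M k) t \<ge> \<epsilon>\<close> for all \<open>k\<close>, where \<open>t\<close>
  depends on \<open>M\<close>. The property \<open>G\<close> below then survives on arbitrarily long lists, since after
  an even number of moves a small value can be inserted: a diagonal sequence \<open>M\<close> is compatible
  with all countably many strategies, and the point \<open>t\<close> belonging to it is already known when
  \<open>n\<close> is chosen from the ultrafilter.
\<close>
lemma not_independent_imp_small_strategy:
  fixes a :: "nat \<Rightarrow> 't::topological_space \<Rightarrow> real"
  assumes U: "ultrafilter U" and K: "compact K"
    and cont: "\<And>n. continuous_on UNIV (a n)"
    and lim: "\<And>t. t \<in> K \<Longrightarrow> ((\<lambda>n. a n t) \<longlongrightarrow> 0) U"
    and eps: "0 < \<epsilon>"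
    and nind: "\<And>e. \<not> independent_on K (\<lambda>i t. a (e i) t \<ge> \<epsilon>) (\<lambda>i t. a (e i) t \<le> \<epsilon> / 2)"
  shows "\<exists>S. strategy U S \<and> (\<forall>M. follows S M \<longrightarrow> \<not> (\<exists>t\<in>K. \<forall>k. a (M k) t \<ge> \<epsilon>))"
proof -
  have Ub: "U \<noteq> bot" using U by (simp add: ultrafilter_def)
  define alt where "alt u t \<longleftrightarrow> (\<forall>i<length u. if even i then a (u ! i) t \<ge> \<epsilon> else a (u ! i) t \<le> \<epsilon> / 2)"
    for u t
  define R where "R u v \<longleftrightarrow> (\<exists>t\<in>K. alt u t \<and> (\<forall>n\<in>set v. a n t \<ge> \<epsilon>))" for u v
  \<comment> \<open>\<open>G []\<close> is the supposition to be refuted: by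
    \<open>strategy_dichotomy\<close> the alternative is a strategy that breaks \<open>R []\<close>,
    and this one proves the claim.\<close>
  define G where "G u \<longleftrightarrow> (\<exists>S. strategy U S \<and> (\<forall>M k. follows S M \<longrightarrow> R u (map M [0..<k])))" for u
  have alt_closed: "closed {t. alt u t}" for u
  proof -
    have "{t. alt u t} = (\<Inter>i\<in>{..<length u}.
        {t. if even i then a (u ! i) t \<ge> \<epsilon> else a (u ! i) t \<le> \<epsilon> / 2})"
      by (auto simp: alt_def)
    also have "closed \<dots>"
    proof (intro closed_INT ballI)
      fix i
      show "closed {t. if even i then a (u ! i) t \<ge> \<epsilon> else a (u ! i) t \<le> \<epsilon> / 2}"
        using cont by (cases "even i") (simp_all add: closed_Collect_le del: le_divide_eq_numeral1)
    qed
    finally show ?thesis .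
  qed
  obtain A where A: "strategy U A"
    "\<And>M. follows A M \<Longrightarrow> \<exists>k. \<not> alternating K (\<lambda>i t. a i t \<ge> \<epsilon>) (\<lambda>i t. a i t \<le> \<epsilon> / 2) (map M [0..<k])"
    using U
  proof (cases rule: independent_or_strategy[where K = K and
        B = "\<lambda>i t. a i t \<ge> \<epsilon>" and L = "\<lambda>i t. a i t \<le> \<epsilon> / 2"])
    case (independent e)
    then show ?thesis using nind by blast
  next
    case (strategy S)
    then show ?thesis by (rule that)
  qed
  have G_step: "\<forall>\<^sub>F n in U. G (u @ [n])" if Gu: "G u" for u
  proof -
    obtain S where S: "strategy U S" "\<And>M k. follows S M \<Longrightarrow> R u (map M [0..<k])"
      using Gu unfolding G_def by blast
    show ?thesis
    proof (cases "even (length u)")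
      case True
      \<comment> \<open>An even position asks for a large value, so a first move offered by
        \<open>S\<close> can be absorbed into the history.\<close>
      have "G (u @ [n])" if n: "S [] n" for n
        unfolding G_def
      proof (intro exI conjI allI impI)
        show "strategy U (\<lambda>v. S (n # v))" using S(1) by (simp add: strategy_def)
        fix M k assume M: "follows (\<lambda>v. S (n # v)) M"
        have "follows S (case_nat n M)"
          unfolding follows_def
        proof
          fix j
          show "S (map (case_nat n M) [0..<j]) (case_nat n M j)"
          proof (cases j)
            case (Suc i)
            have "map (case_nat n M) [0..<Suc i] = n # map M [0..<i]"
              unfolding map_upt_Suc_shift by (simp add: comp_def)
            with M Suc show ?thesis by (simp add: follows_def del: upt_Suc)
          qed (simp add: n)
        qed
        from S(2)[OF this, of "Suc k"] obtain t where t: "t \<in> K" "alt u t"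
          "\<forall>m\<in>set (n # map M [0..<k]). a m t \<ge> \<epsilon>"
          unfolding R_def map_upt_Suc_shift by (auto simp: comp_def)
        then have "alt (u @ [n]) t"
          using True by (auto simp: alt_def nth_append less_Suc_eq)
        with t show "R (u @ [n]) (map M [0..<k])" by (auto simp: R_def)
      qed
      moreover have "eventually (S []) U" using S(1) by (simp add: strategy_def)
      ultimately show ?thesis by (metis (mono_tags, lifting) eventually_mono)
    next
      case False
      show ?thesis
      proof (rule ccontr)
        assume "\<not> ?thesis"
        then have nG: "\<forall>\<^sub>F n in U. \<not> G (u @ [n])"
          using U unfolding ultrafilter_def by blast
        have "\<exists>T. strategy U T \<and> (\<not> G (u @ [n]) \<longrightarrow>
            (\<forall>M. follows T M \<longrightarrow> (\<exists>k. \<not> R (u @ [n]) (map M [0..<k]))))" for n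
          using U
        proof (cases rule: strategy_dichotomy[where R = "R (u @ [n])"])
          case (keep T)
          then have "G (u @ [n])" unfolding G_def by blast
          with keep(1) show ?thesis by blast
        next
          case (break T)
          then show ?thesis by blast
        qed
        then obtain T where T: "\<And>n. strategy U (T n)"
          "\<And>n M. \<not> G (u @ [n]) \<Longrightarrow> follows (T n) M \<Longrightarrow> \<exists>k. \<not> R (u @ [n]) (map M [0..<k])"
          by metis
        define Q where "Q = case_nat S T"
        have "strategy U (Q q)" for q
          using S(1) T(1) by (cases q) (auto simp: Q_def)
        then obtain M :: "nat \<Rightarrow> nat" where
          M: "\<And>q (g :: nat \<Rightarrow> nat). strict_mono g \<Longrightarrow> q \<le> g 0 \<Longrightarrow> follows (Q q) (M \<circ> g)"
          using strategies_diagonal[OF _ Ub, of Q] by metis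
        have "follows S M"
          using M[of id 0] by (simp add: strict_mono_id Q_def)
        define E where "E k = {t. alt u t} \<inter> {t. a (M k) t \<ge> \<epsilon>}" for k
        \<comment> \<open>Each finite part of \<open>M\<close> has its own point; compactness merges
          them into one \<open>t\<close> with large values along all of \<open>M\<close>.\<close>
        have "\<exists>t\<in>K. \<forall>k. t \<in> E k"
        proof (rule compact_fip_sequence[OF K])
          show "closed (E k)" for k
            unfolding E_def using cont
            by (intro closed_Int alt_closed closed_Collect_le continuous_on_const) auto
          show "\<exists>t\<in>K. \<forall>k<n. t \<in> E k" for n
            using S(2)[OF \<open>follows S M\<close>, of n] by (auto simp: R_def E_def)
        qed
        then obtain t where t: "t \<in> K" "alt u t" "\<And>k. a (M k) t \<ge> \<epsilon>"
          unfolding E_def by blast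
        have "\<forall>\<^sub>F n in U. a n t < \<epsilon> / 2"
          using lim[OF t(1)] by (rule order_tendstoD) (use eps in simp)
        with nG have "\<forall>\<^sub>F n in U. \<not> G (u @ [n]) \<and> a n t < \<epsilon> / 2"
          by (rule eventually_conj)
        then obtain n where n: "\<not> G (u @ [n])" "a n t < \<epsilon> / 2"
          using eventually_happens'[OF Ub] by blast
        \<comment> \<open>\<open>T n\<close> has the index \<open>Suc n\<close> in \<open>Q\<close>,
          so the tail of \<open>M\<close> from there on is a play of it. But \<open>t\<close> is
          small at \<open>n\<close> and large on that tail, so \<open>R\<close> is never
          broken.\<close>
        have "follows (Q (Suc n)) (M \<circ> (\<lambda>k. k + Suc n))"
          by (rule M) (auto simp: strict_mono_def)
        then have "follows (T n) (M \<circ> (\<lambda>k. k + Suc n))" by (simp add: Q_def)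
        from T(2)[OF n(1) this] obtain k where
          k: "\<not> R (u @ [n]) (map (M \<circ> (\<lambda>k. k + Suc n)) [0..<k])" ..
        have "alt (u @ [n]) t"
          using False t(2) n(2) by (auto simp: alt_def nth_append less_Suc_eq)
        with t have "R (u @ [n]) (map (M \<circ> (\<lambda>k. k + Suc n)) [0..<k])"
          unfolding R_def by auto
        with k show False ..
      qed
    qed
  qed
  have "\<not> G []"
  proof
    assume G0: "G []"
    \<comment> \<open>The two demands are incompatible: preserving \<open>G\<close> keeps an
      alternating point available at every stage, while \<open>A\<close> ends alternation.\<close>
    define S where "S u n \<longleftrightarrow> A u n \<and> (G u \<longrightarrow> G (u @ [n]))" for u n
    have "eventually (S u) U" for u
    proof -
      have "\<forall>\<^sub>F n in U. A u n \<and> (G u \<longrightarrow> G (u @ [n]))"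
        using A(1) G_step[of u] by (cases "G u") (auto simp: strategy_def intro: eventually_conj)
      then show ?thesis by (simp add: S_def[abs_def])
    qed
    then obtain M where M: "follows S M"
      using strategy_followed[OF _ Ub] unfolding strategy_def by blast
    have GM: "G (map M [0..<k])" for k
    proof (induction k)
      case (Suc k)
      with M show ?case by (simp add: follows_def S_def)
    qed (simp add: G0)
    have "follows A M" using M by (simp add: follows_def S_def)
    from A(2)[OF this] obtain k where
      k: "\<not> alternating K (\<lambda>i t. a i t \<ge> \<epsilon>) (\<lambda>i t. a i t \<le> \<epsilon> / 2) (map M [0..<k])" ..
    obtain T where T: "strategy U T" "\<And>N j. follows T N \<Longrightarrow> R (map M [0..<k]) (map N [0..<j])"
      using GM[of k] unfolding G_def by blast
    then obtain t where "t \<in> K" "alt (map M [0..<k]) t"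
      using strategy_followed[OF T(1) Ub] unfolding R_def by blast
    with k show False unfolding alternating_def alt_def by blast
  qed
  show ?thesis
    using U
  proof (cases rule: strategy_dichotomy[where R = "R []"])
    case (keep S)
    with \<open>\<not> G []\<close> show ?thesis unfolding G_def by blast
  next
    case (break S)
    have "\<not> (\<exists>t\<in>K. \<forall>k. a (M k) t \<ge> \<epsilon>)" if "follows S M" for M
      using break(2)[OF that] by (auto simp: R_def alt_def)
    with break(1) show ?thesis by blast
  qed
qed

section \<open>Finitely additive means\<close>

text \<open>
  Arzela's argument, usually given for finite unions of intervals, works for an arbitrary finitely
  additive set function if the sets themselves are compact.
\<close>
lemma arzela_infinitely_often:
  fixes \<nu> :: "'t::topological_space set \<Rightarrow> real" and E :: "nat \<Rightarrow> 't set"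
  assumes K: "compact K"
    and mono: "\<And>A B. A \<subseteq> B \<Longrightarrow> \<nu> A \<le> \<nu> B"
    and add: "\<And>A B. A \<inter> B = {} \<Longrightarrow> \<nu> (A \<union> B) = \<nu> A + \<nu> B"
    and null: "\<And>A. A \<inter> K = {} \<Longrightarrow> \<nu> A = 0"
    and E: "\<And>k. closed (E k)" "\<And>k. \<eta> \<le> \<nu> (E k)" and "0 < \<eta>"
  shows "\<exists>t\<in>K. \<exists>\<^sub>\<infinity>k. t \<in> E k"
proof -
  define F where "F i m = \<Union>(E ` {i..m})" for i m :: nat
  have F_mono: "m \<le> n \<Longrightarrow> F i m \<subseteq> F i n" for i m n
    by (fastforce simp: F_def)
  \<comment> \<open>A finite union that nearly exhausts all sets from \<open>i\<close> on;
    finiteness keeps it closed. The allowed losses add up to less than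
    \<open>\<eta> / 2\<close>.\<close>
  have "\<exists>m\<ge>i. \<forall>n. \<nu> (F i n) \<le> \<nu> (F i m) + \<eta> / 2 ^ (i + 2)" for i
  proof -
    have bdd: "bdd_above (range (\<lambda>n. \<nu> (F i n)))"
      by (rule bdd_aboveI[of _ "\<nu> UNIV"]) (auto intro: mono)
    have "(SUP n. \<nu> (F i n)) - \<eta> / 2 ^ (i + 2) < (SUP n. \<nu> (F i n))"
      using \<open>0 < \<eta>\<close> by simp
    then obtain m where m: "(SUP n. \<nu> (F i n)) - \<eta> / 2 ^ (i + 2) < \<nu> (F i m)"
      using less_cSUP_iff[OF _ bdd] by auto
    have "\<nu> (F i n) \<le> \<nu> (F i (max i m)) + \<eta> / 2 ^ (i + 2)" for n
      using cSUP_upper[OF UNIV_I bdd, of n] m mono[OF F_mono[of m "max i m" i]] by simp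
    then show ?thesis by (intro exI[of _ "max i m"]) simp
  qed
  then obtain m where m: "\<And>i. m i \<ge> i" "\<And>i n. \<nu> (F i n) \<le> \<nu> (F i (m i)) + \<eta> / 2 ^ (i + 2)"
    by metis
  define G where "G i = F i (m i)" for i
  have diff: "\<nu> (E n - G i) \<le> \<eta> / 2 ^ (i + 2)" if "i \<le> n" for i n
  proof -
    have "\<nu> (E n - G i) + \<nu> (G i) = \<nu> ((E n - G i) \<union> G i)"
      by (rule add[symmetric]) auto
    also have "\<dots> \<le> \<nu> (F i (max n (m i)))"
      using that by (intro mono) (fastforce simp: G_def F_def)
    also have "\<dots> \<le> \<nu> (G i) + \<eta> / 2 ^ (i + 2)"
      unfolding G_def by (rule m(2))
    finally show ?thesis by simp
  qed
  have split: "\<nu> A = \<nu> (A \<inter> B) + \<nu> (A - B)" for A B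
    using add[of "A \<inter> B" "A - B"] by (simp add: Int_Diff_Un Int_Diff_disjoint)
  \<comment> \<open>What is left of \<open>\<eta>\<close> after the losses
    \<open>\<eta> / 2 ^ (i + 2)\<close> for \<open>i \<le> N\<close>; the geometric sum gives
    exactly this bound.\<close>
  have H: "\<nu> (E n \<inter> (\<Inter>i\<le>N. G i)) \<ge> \<eta> / 2 + \<eta> / 2 ^ (N + 2)" if "N \<le> n" for n N
    using that
  proof (induction N)
    case 0
    have "\<nu> (E n \<inter> G 0) \<ge> \<eta> - \<eta> / 4"
      using split[of "E n" "G 0"] diff[of 0 n] E(2)[of n] by simp
    then show ?case by simp
  next
    case (Suc N)
    have "E n \<inter> (\<Inter>i\<le>Suc N. G i) = (E n \<inter> (\<Inter>i\<le>N. G i)) \<inter> G (Suc N)"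
      by (auto simp: atMost_Suc)
    moreover have "\<nu> (E n \<inter> (\<Inter>i\<le>N. G i) - G (Suc N)) \<le> \<eta> / 2 ^ (Suc N + 2)"
      by (rule order_trans[OF mono diff[OF Suc.prems]]) auto
    moreover have "\<eta> / 2 ^ (N + 2) = 2 * (\<eta> / 2 ^ (Suc N + 2))"
      by simp
    ultimately show ?case
      using split[of "E n \<inter> (\<Inter>i\<le>N. G i)" "G (Suc N)"] Suc by simp
  qed
  have "\<exists>t\<in>K. \<forall>i. t \<in> G i"
  proof (rule compact_fip_sequence[OF K])
    show "closed (G i)" for i
      unfolding G_def F_def by (intro closed_UN) (auto simp: E)
    fix n
    have "0 < \<eta> / 2 + \<eta> / 2 ^ (n + 2)" using \<open>0 < \<eta>\<close> by (simp add: add_pos_pos)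
    with H[of n n] have "\<nu> (E n \<inter> (\<Inter>i\<le>n. G i)) \<noteq> 0" by simp
    with null have "(E n \<inter> (\<Inter>i\<le>n. G i)) \<inter> K \<noteq> {}" by metis
    then show "\<exists>t\<in>K. \<forall>k<n. t \<in> G k" by fastforce
  qed
  then obtain t where t: "t \<in> K" "\<And>i. t \<in> G i" by blast
  have "\<exists>\<^sub>\<infinity>k. t \<in> E k"
    unfolding INFM_nat_le using t(2) by (fastforce simp: G_def F_def)
  with t(1) show ?thesis by blast
qed

section \<open>Bounded functions and their means\<close>

definition bounded_fun_on :: "'t set \<Rightarrow> ('t \<Rightarrow> real) \<Rightarrow> bool" where
  "bounded_fun_on K f \<longleftrightarrow> (\<exists>b. \<forall>t\<in>K. \<bar>f t\<bar> \<le> b)"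

lemma bounded_fun_onI: "(\<And>t. t \<in> K \<Longrightarrow> \<bar>f t\<bar> \<le> b) \<Longrightarrow> bounded_fun_on K f"
  by (auto simp: bounded_fun_on_def)

lemma bounded_fun_on_const: "bounded_fun_on K (\<lambda>_. c)"
  by (rule bounded_fun_onI[of _ _ "\<bar>c\<bar>"]) simp

lemma bounded_fun_on_indicator: "bounded_fun_on K (indicat_real A)"
  by (rule bounded_fun_onI[of _ _ 1]) (simp add: indicator_def)

lemma bounded_fun_on_add:
  assumes "bounded_fun_on K f" "bounded_fun_on K g"
  shows "bounded_fun_on K (\<lambda>t. f t + g t)"
proof -
  obtain b c where "\<forall>t\<in>K. \<bar>f t\<bar> \<le> b" "\<forall>t\<in>K. \<bar>g t\<bar> \<le> c"
    using assms unfolding bounded_fun_on_def by blast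
  then have "\<bar>f t + g t\<bar> \<le> b + c" if "t \<in> K" for t
    using that by (intro order_trans[OF abs_triangle_ineq] add_mono) auto
  then show ?thesis by (rule bounded_fun_onI)
qed

lemma bounded_fun_on_mult:
  assumes "bounded_fun_on K f" "bounded_fun_on K g"
  shows "bounded_fun_on K (\<lambda>t. f t * g t)"
proof -
  obtain b c where "\<forall>t\<in>K. \<bar>f t\<bar> \<le> b" "\<forall>t\<in>K. \<bar>g t\<bar> \<le> c"
    using assms unfolding bounded_fun_on_def by blast
  then have "\<bar>f t * g t\<bar> \<le> \<bar>b\<bar> * \<bar>c\<bar>" if "t \<in> K" for t
    unfolding abs_mult using that by (intro mult_mono) fastforce+
  then show ?thesis by (rule bounded_fun_onI)
qed

lemma bounded_fun_on_diff:
  assumes "bounded_fun_on K f" "bounded_fun_on K g"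
  shows "bounded_fun_on K (\<lambda>t. f t - g t)"
  using bounded_fun_on_add[OF assms(1) bounded_fun_on_mult[OF bounded_fun_on_const[of K "-1"] assms(2)]]
  by simp

lemma bounded_fun_on_abs: "bounded_fun_on K f \<Longrightarrow> bounded_fun_on K (\<lambda>t. \<bar>f t\<bar>)"
  by (simp add: bounded_fun_on_def)

lemma bounded_fun_on_sgn: "bounded_fun_on K (\<lambda>t. sgn (f t :: real))"
  by (rule bounded_fun_onI[of _ _ 1]) (simp add: sgn_if)

lemmas bounded_fun_on_intros =
  bounded_fun_on_const bounded_fun_on_indicator bounded_fun_on_add bounded_fun_on_mult
  bounded_fun_on_diff bounded_fun_on_abs bounded_fun_on_sgn

locale mean =
  fixes K :: "'t set" and \<Lambda> :: "('t \<Rightarrow> real) \<Rightarrow> real"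
  assumes add: "bounded_fun_on K f \<Longrightarrow> bounded_fun_on K g \<Longrightarrow> \<Lambda> (\<lambda>t. f t + g t) = \<Lambda> f + \<Lambda> g"
    and cmult: "bounded_fun_on K f \<Longrightarrow> \<Lambda> (\<lambda>t. c * f t) = c * \<Lambda> f"
    and mono: "bounded_fun_on K f \<Longrightarrow> bounded_fun_on K g \<Longrightarrow> (\<And>t. t \<in> K \<Longrightarrow> f t \<le> g t) \<Longrightarrow> \<Lambda> f \<le> \<Lambda> g"
    and one: "\<Lambda> (\<lambda>_. 1) = 1"

text \<open>The average over all \<open>2 ^ N\<close> patterns treats large and small as fair coin
  tosses. For \<open>i \<noteq> j\<close> a quarter of the patterns contain \<open>i\<close> but not
  \<open>j\<close>, and there the two values differ by at least \<open>s - r\<close>; this is the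
  constant. The bound survives the limit along a free ultrafilter.\<close>

lemma independent_on_separating_mean:
  fixes a :: "nat \<Rightarrow> 't \<Rightarrow> real"
  assumes bdd: "\<And>i. bounded_fun_on K (a i)"
    and ind: "independent_on K (\<lambda>i t. a i t \<ge> s) (\<lambda>i t. a i t \<le> r)" and "r < s"
  obtains \<Lambda> where "mean K \<Lambda>" "\<And>i j. i \<noteq> j \<Longrightarrow> (s - r) / 4 \<le> \<Lambda> (\<lambda>t. \<bar>a i t - a j t\<bar>)"
proof -
  obtain \<tau> where \<tau>: "\<And>N P. \<tau> N P \<in> K"
    "\<And>N P i. i < N \<Longrightarrow> if i \<in> P then a i (\<tau> N P) \<ge> s else a i (\<tau> N P) \<le> r"
    using ind unfolding independent_on_def by metis
  obtain U :: "nat filter" where U: "U \<le> sequentially" "ultrafilter U"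
    using ultrafilter_exists[of sequentially] by auto
  then have Ub: "U \<noteq> bot" by (simp add: ultrafilter_def)
  define m where "m N f = (\<Sum>P\<in>Pow {..<N}. f (\<tau> N P)) / 2 ^ N" for N :: nat and f :: "'t \<Rightarrow> real"
  define \<Lambda> where "\<Lambda> f = Lim U (\<lambda>N. m N f)" for f
  have m_mono: "m N f \<le> m N g" if "\<And>t. t \<in> K \<Longrightarrow> f t \<le> g t" for N f g
    unfolding m_def by (intro divide_right_mono sum_mono that \<tau>) simp
  have m_const: "m N (\<lambda>_. c) = c" for N c
    by (simp add: m_def card_Pow)
  have lim: "((\<lambda>N. m N f) \<longlongrightarrow> \<Lambda> f) U" if f: "bounded_fun_on K f" for f
  proof -
    obtain b where b: "\<forall>t\<in>K. \<bar>f t\<bar> \<le> b"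
      using f unfolding bounded_fun_on_def by blast
    have "\<bar>m N f\<bar> \<le> b" for N
    proof (rule abs_leI)
      show "m N f \<le> b"
        using m_mono[of f "\<lambda>_. b" N] b by (auto simp: m_const abs_le_iff)
      have "m N (\<lambda>_. - b) \<le> m N f"
        using b by (intro m_mono) (fastforce simp: abs_le_iff)
      then show "- m N f \<le> b" by (simp add: m_const)
    qed
    then obtain l where "((\<lambda>N. m N f) \<longlongrightarrow> l) U"
      using ultrafilter_tendsto[OF U(2), of "\<lambda>N. m N f" b] by auto
    then show ?thesis
      unfolding \<Lambda>_def using tendsto_Lim[OF Ub] by metis
  qed
  have "mean K \<Lambda>"
  proof
    fix f g assume fg: "bounded_fun_on K f" "bounded_fun_on K g"
    have "((\<lambda>N. m N f + m N g) \<longlongrightarrow> \<Lambda> f + \<Lambda> g) U"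
      using fg by (intro tendsto_add lim)
    moreover have "m N f + m N g = m N (\<lambda>t. f t + g t)" for N
      by (simp add: m_def sum.distrib add_divide_distrib)
    ultimately show "\<Lambda> (\<lambda>t. f t + g t) = \<Lambda> f + \<Lambda> g"
      using tendsto_unique[OF Ub lim[OF bounded_fun_on_add[OF fg]]] by simp
    assume "\<And>t. t \<in> K \<Longrightarrow> f t \<le> g t"
    then show "\<Lambda> f \<le> \<Lambda> g"
      by (intro tendsto_le[OF Ub lim[OF fg(2)] lim[OF fg(1)]] always_eventually allI m_mono)
  next
    fix f c assume f: "bounded_fun_on K f"
    have "((\<lambda>N. c * m N f) \<longlongrightarrow> c * \<Lambda> f) U"
      using f by (intro tendsto_mult_left lim)
    moreover have "c * m N f = m N (\<lambda>t. c * f t)" for N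
      by (simp add: m_def sum_distrib_left)
    ultimately show "\<Lambda> (\<lambda>t. c * f t) = c * \<Lambda> f"
      using tendsto_unique[OF Ub lim[OF bounded_fun_on_mult[OF bounded_fun_on_const f]]] by simp
  next
    show "\<Lambda> (\<lambda>_. 1) = 1"
      using tendsto_unique[OF Ub lim[OF bounded_fun_on_const, of 1]] by (simp add: m_const)
  qed
  moreover have "(s - r) / 4 \<le> \<Lambda> (\<lambda>t. \<bar>a i t - a j t\<bar>)" if "i \<noteq> j" for i j
  proof -
    have b: "bounded_fun_on K (\<lambda>t. \<bar>a i t - a j t\<bar>)"
      by (intro bounded_fun_on_intros bdd)
    have "(s - r) / 4 \<le> m N (\<lambda>t. \<bar>a i t - a j t\<bar>)" if N: "max i j < N" for N
    proof -
      let ?A = "insert i ` Pow ({..<N} - {i, j})"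
      have inj: "inj_on (insert i) (Pow ({..<N} - {i, j}))"
        by (auto simp: inj_on_def)
      have "card ({..<N} - {i, j}) = N - 2"
        using N \<open>i \<noteq> j\<close> by (subst card_Diff_subset) auto
      then have card: "card ?A = 2 ^ (N - 2)"
        by (simp add: card_image[OF inj] card_Pow)
      have N2: "N = Suc (Suc (N - 2))" using N \<open>i \<noteq> j\<close> by linarith
      have "(s - r) / 4 * 2 ^ N = of_nat (card ?A) * (s - r)"
        unfolding card by (subst (1) N2) (simp add: field_simps)
      also have "\<dots> \<le> (\<Sum>P\<in>?A. \<bar>a i (\<tau> N P) - a j (\<tau> N P)\<bar>)"
      proof (rule sum_bounded_below)
        fix P assume "P \<in> ?A"
        then have "i \<in> P" "j \<notin> P" using \<open>i \<noteq> j\<close> by auto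
        with \<tau>(2)[of i N P] \<tau>(2)[of j N P] N
        show "s - r \<le> \<bar>a i (\<tau> N P) - a j (\<tau> N P)\<bar>" by auto
      qed
      also have "\<dots> \<le> (\<Sum>P\<in>Pow {..<N}. \<bar>a i (\<tau> N P) - a j (\<tau> N P)\<bar>)"
        using N by (intro sum_mono2) auto
      finally show ?thesis by (simp add: m_def field_simps)
    qed
    then have "\<forall>\<^sub>F N in U. (s - r) / 4 \<le> m N (\<lambda>t. \<bar>a i t - a j t\<bar>)"
      by (intro filter_leD[OF U(1)] eventually_mono[OF eventually_gt_at_top[of "max i j"]])
    then show ?thesis
      using tendsto_lowerbound[OF lim[OF b] _ Ub] by blast
  qed
  ultimately show ?thesis by (rule that)
qed

context mean
begin

lemma zero: "\<Lambda> (\<lambda>_. 0) = 0"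
  using cmult[OF bounded_fun_on_const, of 0 0] by simp

lemma indicator_mono: "A \<subseteq> B \<Longrightarrow> \<Lambda> (indicat_real A) \<le> \<Lambda> (indicat_real B)"
  by (rule mono) (auto simp: bounded_fun_on_indicator indicator_def)

lemma indicator_add:
  assumes "A \<inter> B = {}"
  shows "\<Lambda> (indicat_real (A \<union> B)) = \<Lambda> (indicat_real A) + \<Lambda> (indicat_real B)"
proof -
  have "indicat_real (A \<union> B) = (\<lambda>t. indicat_real A t + indicat_real B t)"
    using assms by (intro ext) (auto simp: indicator_def)
  then show ?thesis by (simp add: add bounded_fun_on_indicator)
qed

lemma indicator_null:
  assumes "A \<inter> K = {}"
  shows "\<Lambda> (indicat_real A) = 0"
proof (rule antisym)
  have eq: "indicat_real A t = 0" if "t \<in> K" for t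
    using assms that by (auto simp: indicator_def)
  show "\<Lambda> (indicat_real A) \<le> 0"
    using mono[OF bounded_fun_on_indicator bounded_fun_on_const, of A 0] eq by (simp add: zero)
  show "0 \<le> \<Lambda> (indicat_real A)"
    using mono[OF bounded_fun_on_const bounded_fun_on_indicator, of 0 A] eq by (simp add: zero)
qed

end

lemma continuous_on_evaluation: "continuous_on UNIV (\<lambda>t :: 'a \<Rightarrow> real. t z)"
  by (rule continuous_on_product_coordinates)

text \<open>Otherwise \<open>C\<close> contains a \<open>\<delta>\<close>-separated sequence.
  Consecutive differences along a pointwise convergent subsequence tend to \<open>0\<close> on
  \<open>K\<close>, yet each has seminorm at least \<open>\<delta>\<close>. Since they are uniformly
  bounded, the sets where they exceed \<open>\<delta> / 2\<close> have mean bounded away from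
  \<open>0\<close>, and some point of \<open>K\<close> lies in infinitely many of them.\<close>

lemma mean_totally_bounded:
  fixes K :: "('a::real_vector \<Rightarrow> real) set"
  assumes "mean K \<Lambda>" and K: "compact K" and lin: "\<And>t. t \<in> K \<Longrightarrow> linear t"
    and bdd: "\<And>t c. t \<in> K \<Longrightarrow> c \<in> C \<Longrightarrow> \<bar>t c\<bar> \<le> B"
    and sub: "\<And>y :: nat \<Rightarrow> 'a. range y \<subseteq> C \<Longrightarrow>
      \<exists>g. strict_mono g \<and> (\<forall>t\<in>K. convergent (\<lambda>n. t (y (g n))))"
    and "0 < \<delta>"
  shows "\<exists>F. finite F \<and> F \<subseteq> C \<and> (\<forall>c\<in>C. \<exists>f\<in>F. \<Lambda> (\<lambda>t. \<bar>t (c - f)\<bar>) < \<delta>)"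
proof (rule ccontr)
  interpret mean K \<Lambda> by fact
  assume no: "\<not> ?thesis"
  have "\<forall>l. \<exists>c. set l \<subseteq> C \<longrightarrow> c \<in> C \<and> (\<forall>f\<in>set l. \<delta> \<le> \<Lambda> (\<lambda>t. \<bar>t (c - f)\<bar>))"
  proof
    fix l
    have "\<not> (finite (set l) \<and> set l \<subseteq> C \<and> (\<forall>c\<in>C. \<exists>f\<in>set l. \<Lambda> (\<lambda>t. \<bar>t (c - f)\<bar>) < \<delta>))"
      using no by (rule contrapos_nn) (rule exI)
    then show "\<exists>c. set l \<subseteq> C \<longrightarrow> c \<in> C \<and> (\<forall>f\<in>set l. \<delta> \<le> \<Lambda> (\<lambda>t. \<bar>t (c - f)\<bar>))"
      by (auto simp: not_less)
  qed
  from choice[OF this] obtain c where c: "\<And>l. set l \<subseteq> C \<Longrightarrow> c l \<in> C"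
    "\<And>l f. set l \<subseteq> C \<Longrightarrow> f \<in> set l \<Longrightarrow> \<delta> \<le> \<Lambda> (\<lambda>t. \<bar>t (c l - f)\<bar>)"
    by auto
  obtain y where y: "\<And>k. y k = c (map y [0..<k])"
    using course_of_values_sequence[of c] by blast
  have yC: "y k \<in> C" for k
  proof (induction k rule: less_induct)
    case (less k)
    then show ?case by (subst y) (rule c(1), auto)
  qed
  have sep: "\<Lambda> (\<lambda>t. \<bar>t (y k - y j)\<bar>) \<ge> \<delta>" if "j < k" for j k
    using c(2)[of "map y [0..<k]" "y j"] that yC by (auto simp: y[symmetric])
  obtain g where g: "strict_mono g" "\<And>t. t \<in> K \<Longrightarrow> convergent (\<lambda>n. t (y (g n)))"
    using sub[of y] yC by blast
  define z where "z k = y (g (Suc k)) - y (g k)" for k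
  have zlim: "(\<lambda>k. t (z k)) \<longlonglongrightarrow> 0" if "t \<in> K" for t
  proof -
    obtain l where l: "(\<lambda>n. t (y (g n))) \<longlonglongrightarrow> l"
      using g(2)[OF \<open>t \<in> K\<close>] unfolding convergent_def ..
    show ?thesis
      using tendsto_diff[OF LIMSEQ_Suc[OF l] l] lin[OF that]
      by (simp add: z_def linear_diff)
  qed
  have zb: "\<bar>t (z k)\<bar> \<le> 2 * \<bar>B\<bar> + 1" if "t \<in> K" for t k
    using bdd[OF that yC, of "g (Suc k)"] bdd[OF that yC, of "g k"] lin[OF that]
    by (simp add: z_def linear_diff)
  \<comment> \<open>The summand \<open>1\<close> keeps \<open>D\<close> positive when
    \<open>B = 0\<close>; \<open>D\<close> is a divisor below.\<close>
  define D where "D = 2 * \<bar>B\<bar> + 1"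
  have "D > 0" by (simp add: D_def)
  define E where "E k = {t. \<bar>t (z k)\<bar> \<ge> \<delta> / 2}" for k
  have closedK: "closed {t. \<bar>t (z k)\<bar> \<ge> \<delta> / 2}" for k
    by (intro closed_Collect_le continuous_on_const continuous_on_rabs continuous_on_evaluation)
  \<comment> \<open>Chebyshev's inequality: half of \<open>\<delta>\<close> is absorbed by the
    points outside \<open>E k\<close>.\<close>
  have \<nu>E: "\<delta> / (2 * D) \<le> \<Lambda> (indicat_real (E k))" for k
  proof -
    have b: "bounded_fun_on K (\<lambda>t. \<bar>t (z k)\<bar>)"
      by (rule bounded_fun_onI[of _ _ D]) (simp add: zb D_def)
    have "\<delta> \<le> \<Lambda> (\<lambda>t. \<bar>t (z k)\<bar>)"
      unfolding z_def using g(1) by (intro sep) (simp add: strict_mono_def)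
    also have "\<dots> \<le> \<Lambda> (\<lambda>t. D * indicat_real (E k) t + \<delta> / 2 * 1)"
    proof (rule mono[OF b])
      show "\<bar>t (z k)\<bar> \<le> D * indicat_real (E k) t + \<delta> / 2 * 1" if "t \<in> K" for t
        using zb[OF that, of k] that \<open>0 < \<delta>\<close> by (auto simp: E_def D_def indicator_def)
    qed (intro bounded_fun_on_intros)
    also have "\<dots> = D * \<Lambda> (indicat_real (E k)) + \<delta> / 2"
      by (subst add, (intro bounded_fun_on_intros)+, subst (1 2) cmult, (intro bounded_fun_on_intros)+)
        (simp add: one)
    finally show ?thesis
      using \<open>D > 0\<close> by (simp add: field_simps)
  qed
  have "\<exists>t\<in>K. \<exists>\<^sub>\<infinity>k. t \<in> E k"
  proof (rule arzela_infinitely_often[OF K indicator_mono indicator_add indicator_null])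
    show "closed (E k)" for k
      unfolding E_def by (rule closedK)
    show "\<delta> / (2 * D) \<le> \<Lambda> (indicat_real (E k))" for k
      by (rule \<nu>E)
    show "0 < \<delta> / (2 * D)"
      using \<open>0 < \<delta>\<close> \<open>0 < D\<close> by simp
  qed
  then obtain t where t: "t \<in> K" "\<exists>\<^sub>\<infinity>k. t \<in> E k" by blast
  have "\<forall>\<^sub>F k in sequentially. \<bar>t (z k)\<bar> < \<delta> / 2"
    using tendsto_rabs_zero[OF zlim[OF t(1)]] by (rule order_tendstoD) (use \<open>0 < \<delta>\<close> in simp)
  then have "\<forall>\<^sub>\<infinity>k. t \<notin> E k"
    unfolding cofinite_eq_sequentially by (rule eventually_mono) (simp add: E_def)
  with t(2) show False
    by (simp add: frequently_def)
qed

section \<open>Polars and the weak topology\<close>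

lemma tendsto_scaleR_tvs:
  fixes g :: "'b \<Rightarrow> 'a::topological_real_vector"
  assumes "(f \<longlongrightarrow> c) F" "(g \<longlongrightarrow> x) F"
  shows "((\<lambda>t. f t *\<^sub>R g t) \<longlongrightarrow> c *\<^sub>R x) F"
  using filterlim_compose[OF tendsto_scaleR_Pair filterlim_Pair[OF assms]] by simp

lemma open_affine_vimage:
  fixes V :: "'a::topological_real_vector set"
  assumes "open V"
  shows "open {y. c *\<^sub>R (y - x) \<in> V}"
proof -
  have "continuous_on UNIV (\<lambda>y. c *\<^sub>R (y - x))"
    unfolding continuous_on_def
    by (intro ballI tendsto_scaleR_tvs tendsto_const tendsto_diff tendsto_ident_at)
  from open_vimage[OF assms this] show ?thesis by (simp add: vimage_def)
qed

lemma open_absorbing: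
  fixes V :: "'a::topological_real_vector set"
  assumes "open V" "0 \<in> V"
  shows "\<exists>c>0. c *\<^sub>R x \<in> V"
proof -
  have "((\<lambda>c. c *\<^sub>R x) \<longlongrightarrow> 0 *\<^sub>R x) (at_right 0)"
    by (intro tendsto_scaleR_tvs tendsto_const) (rule tendsto_ident_at)
  then have "\<forall>\<^sub>F c in at_right 0. c *\<^sub>R x \<in> V"
    using assms by (simp add: topological_tendstoD)
  then have "\<forall>\<^sub>F c in at_right (0::real). 0 < c \<and> c *\<^sub>R x \<in> V"
    using eventually_at_right_less by (rule eventually_conj[rotated])
  then show ?thesis
    using eventually_happens'[OF trivial_limit_at_right_real] by blast
qed

lemma metrizable_decseq_base:
  fixes x :: "'a::topological_space"
  assumes "metrizable_space (euclidean :: 'a topology)"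
  obtains V :: "nat \<Rightarrow> 'a set" where "\<And>n. open (V n)" "\<And>n. x \<in> V n" "decseq V"
    "\<And>U. open U \<Longrightarrow> x \<in> U \<Longrightarrow> \<exists>n. V n \<subseteq> U"
proof -
  obtain M d where Md: "Metric_space M d" "(euclidean :: 'a topology) = Metric_space.mtopology M d"
    using assms unfolding metrizable_space_def by blast
  interpret Metric_space M d by fact
  have M: "M = UNIV" using Md(2) topspace_mtopology by (metis topspace_euclidean)
  define V where "V n = mball x (1 / Suc n)" for n
  show ?thesis
  proof (rule that)
    show "open (V n)" for n
      unfolding V_def open_openin Md(2) by (rule openin_mball)
    show "x \<in> V n" for n
    proof -
      have "x \<in> M" using M by simp
      then show ?thesis by (simp add: V_def)
    qed
    show "decseq V"
      unfolding V_def by (intro decseq_SucI mball_subset_concentric) (simp add: field_simps)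
    show "\<exists>n. V n \<subseteq> U" if U: "open U" "x \<in> U" for U
    proof -
      obtain r where r: "r > 0" "mball x r \<subseteq> U"
        using U openin_mtopology[of U] unfolding open_openin Md(2) by blast
      obtain n where "1 / Suc n < r" using nat_approx_posE[OF r(1)] by blast
      then have "V n \<subseteq> mball x r" unfolding V_def by (intro mball_subset_concentric) simp
      with r(2) show ?thesis by blast
    qed
  qed
qed

text \<open>Tychonoff's theorem for the type class topology on functions.\<close>

lemma compact_pointwise:
  fixes S :: "'i \<Rightarrow> 'b::topological_space set"
  assumes "\<And>i. compact (S i)"
  shows "compact {f. \<forall>i. f i \<in> S i}"
proof -
  have "compactin (product_topology (\<lambda>_. euclidean) UNIV) (PiE UNIV S)"
    unfolding compactin_PiE using assms by simp
  moreover have "PiE UNIV S = {f. \<forall>i. f i \<in> S i}"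
    by (auto simp: PiE_def Pi_def)
  ultimately show ?thesis
    by (simp add: euclidean_product_topology)
qed

text \<open>Continuity is left out so that only pointwise conditions remain, which makes the set
  closed under pointwise convergence. For a neighbourhood \<open>V\<close> of \<open>0\<close> it is
  automatic (\<open>polar_subset_dual\<close>).\<close>

definition polar :: "'a::real_vector set \<Rightarrow> ('a \<Rightarrow> real) set" where
  "polar V = {f. linear f \<and> (\<forall>v\<in>V. \<bar>f v\<bar> \<le> 1)}"

lemma polar_linear: "t \<in> polar V \<Longrightarrow> linear t"
  by (simp add: polar_def)

lemma polar_anti_mono: "V \<subseteq> W \<Longrightarrow> polar W \<subseteq> polar V"
  by (auto simp: polar_def)

lemma polar_scaleR_bound:
  assumes "t \<in> polar V" "c *\<^sub>R x \<in> V" "c > 0"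
  shows "\<bar>t x\<bar> \<le> 1 / c"
proof -
  have "\<bar>t (c *\<^sub>R x)\<bar> \<le> 1" using assms by (simp add: polar_def)
  moreover have "t (c *\<^sub>R x) = c * t x" using assms(1) by (simp add: polar_def linear_scale)
  ultimately show ?thesis using assms(3) by (simp add: field_simps abs_mult)
qed

lemma polar_subset_dual:
  fixes V :: "'a::topological_real_vector set"
  assumes V: "open V" "0 \<in> V"
  shows "polar V \<subseteq> topological_dual"
proof
  fix t assume t: "t \<in> polar V"
  have "(t \<longlongrightarrow> t x) (at x)" for x
  proof (rule tendstoI)
    fix e :: real assume "0 < e"
    \<comment> \<open>The factor \<open>2 / e\<close> gives the bound \<open>e / 2\<close>, hence
      the strict inequality.\<close>
    have "open {y. (2 / e) *\<^sub>R (y - x) \<in> V}"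
      by (rule open_affine_vimage[OF V(1)])
    then have "\<forall>\<^sub>F y in at x. (2 / e) *\<^sub>R (y - x) \<in> V"
      using V(2) by (auto simp: eventually_at_topological)
    then show "\<forall>\<^sub>F y in at x. dist (t y) (t x) < e"
    proof (rule eventually_mono)
      fix y assume "(2 / e) *\<^sub>R (y - x) \<in> V"
      from polar_scaleR_bound[OF t this] \<open>0 < e\<close> show "dist (t y) (t x) < e"
        by (simp add: dist_real_def linear_diff[OF polar_linear[OF t]])
    qed
  qed
  then show "t \<in> topological_dual"
    using t by (simp add: topological_dual_def polar_linear continuous_on_def)
qed

lemma dual_in_polar:
  assumes "f \<in> topological_dual" and base: "\<And>U. open U \<Longrightarrow> 0 \<in> U \<Longrightarrow> \<exists>n. V n \<subseteq> U"
  shows "\<exists>n. f \<in> polar (V n)"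
proof -
  have f: "linear f" "continuous_on UNIV f" using assms(1) by (auto simp: topological_dual_def)
  have "open (f -` ball 0 1)" using open_vimage[OF open_ball f(2)] .
  moreover have "0 \<in> f -` ball 0 1" using linear_0[OF f(1)] by simp
  ultimately obtain n where n: "V n \<subseteq> f -` ball 0 1" using base by blast
  have "\<bar>f v\<bar> \<le> 1" if "v \<in> V n" for v
    using subsetD[OF n that] by (simp add: dist_real_def)
  with f show ?thesis by (auto simp: polar_def)
qed

text \<open>The Banach-Alaoglu theorem: since \<open>V\<close> is absorbing, the polar is a closed
  subset of a product of compact intervals.\<close>

lemma compact_polar:
  fixes V :: "'a::topological_real_vector set"
  assumes V: "open V" "0 \<in> V"
  shows "compact (polar V)"
proof -
  obtain c where c: "\<And>x. c x > 0" "\<And>x. c x *\<^sub>R x \<in> V"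
    using open_absorbing[OF V] by metis
  have "compact {f. \<forall>x. f x \<in> {- (1 / c x)..1 / c x}}"
    by (rule compact_pointwise) (rule compact_Icc)
  moreover have "closed (polar V)"
  proof -
    have "polar V = {f. \<forall>x y. f (x + y) = f x + f y} \<inter> {f. \<forall>r x. f (r *\<^sub>R x) = r * f x}
        \<inter> {f. \<forall>v. v \<in> V \<longrightarrow> \<bar>f v\<bar> \<le> 1}"
      by (auto simp: polar_def linear_iff)
    also have "closed \<dots>"
      by (intro closed_Int closed_Collect_all closed_Collect_eq closed_Collect_imp closed_Collect_le
          open_Collect_const continuous_intros continuous_on_evaluation)
    finally show ?thesis .
  qed
  ultimately have "compact ({f. \<forall>x. f x \<in> {- (1 / c x)..1 / c x}} \<inter> polar V)"
    by (rule compact_Int_closed)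
  moreover have "polar V \<subseteq> {f. \<forall>x. f x \<in> {- (1 / c x)..1 / c x}}"
  proof safe
    fix t x assume "t \<in> polar V"
    from polar_scaleR_bound[OF this c(2)[of x] c(1)] show "t x \<in> {- (1 / c x)..1 / c x}"
      by (simp add: abs_le_iff)
  qed
  ultimately show ?thesis by (simp add: Int_absorb1)
qed

lemma tvs_bounded_polar:
  assumes "tvs_bounded C" "open V" "0 \<in> V"
  shows "\<exists>B. \<forall>t\<in>polar V. \<forall>c\<in>C. \<bar>t c\<bar> \<le> B"
proof -
  obtain s where s: "s > 0" "\<And>t. t > s \<Longrightarrow> C \<subseteq> (\<lambda>u. t *\<^sub>R u) ` V"
    using assms unfolding tvs_bounded_def by blast
  have "\<bar>t c\<bar> \<le> s + 1" if t: "t \<in> polar V" "c \<in> C" for t c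
  proof -
    obtain u where "u \<in> V" "c = (s + 1) *\<^sub>R u"
      using s(2)[of "s + 1"] t(2) by auto
    then show ?thesis
      using polar_scaleR_bound[OF t(1), of "1 / (s + 1)" c] s(1) by simp
  qed
  then show ?thesis by blast
qed

section \<open>Convergence and finite approximation in the weak topology\<close>

lemma openin_weak_vimage:
  assumes "f \<in> topological_dual" "open U"
  shows "openin weak_topology (f -` U)"
  unfolding weak_topology_def using assms by (intro topology_generated_by_Basis) auto

lemma limitin_weak_topologyI:
  assumes "\<And>f. f \<in> topological_dual \<Longrightarrow> ((\<lambda>n. f (\<xi> n)) \<longlongrightarrow> f x) F"
  shows "limitin weak_topology \<xi> x F"
proof -
  have "\<forall>\<^sub>F n in F. \<xi> n \<in> W" if "openin weak_topology W" "x \<in> W" for W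
  proof -
    have "generate_topology_on {f -` U | f U. f \<in> topological_dual \<and> open U} W"
      using that(1) by (simp add: weak_topology_def openin_topology_generated_by_iff)
    then show ?thesis
      using that(2)
    proof induction
      case (Int a b)
      then show ?case by (simp add: eventually_conj)
    next
      case (UN K)
      then obtain k where "k \<in> K" "x \<in> k" by blast
      with UN.IH[OF this] show ?case by (auto elim: eventually_mono)
    next
      case (Basis s)
      then show ?case using assms topological_tendstoD by fastforce
    qed simp
  qed
  then show ?thesis by (simp add: limitin_def topspace_weak_topology)
qed

lemma weak_closure_of_approx:
  assumes x: "x \<in> weak_topology closure_of A" and F: "finite F" "F \<subseteq> topological_dual" and "0 < e"
  shows "\<exists>a\<in>A. \<forall>f\<in>F. \<bar>f a - f x\<bar> < e"
proof -
  have "openin weak_topology ((\<Inter>f\<in>F. f -` ball (f x) e) \<inter> topspace weak_topology)"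
    using F by (intro openin_INT ballI openin_weak_vimage) auto
  then have "openin weak_topology (\<Inter>f\<in>F. f -` ball (f x) e)"
    by (simp add: topspace_weak_topology)
  moreover have "x \<in> (\<Inter>f\<in>F. f -` ball (f x) e)" using \<open>0 < e\<close> by simp
  ultimately obtain a where "a \<in> A" "a \<in> (\<Inter>f\<in>F. f -` ball (f x) e)"
    using x unfolding in_closure_of by blast
  then show ?thesis by (force simp: dist_real_def abs_minus_commute)
qed

text \<open>
  The weak topology of a metrizable space has countable tightness because the dual is the union of
  countably many compact polars, whose finite powers are compact.
\<close>
lemma compact_finite_approx:
  fixes K :: "('a \<Rightarrow> real) set" and A :: "'a set"
  assumes K: "compact K"
    and approx: "\<And>F. finite F \<Longrightarrow> F \<subseteq> K \<Longrightarrow> \<exists>a\<in>A. \<forall>f\<in>F. \<bar>f a - f x\<bar> < e"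
  shows "\<exists>A'. finite A' \<and> A' \<subseteq> A \<and>
    (\<forall>F. finite F \<longrightarrow> card F \<le> k \<longrightarrow> F \<subseteq> K \<longrightarrow> (\<exists>a\<in>A'. \<forall>f\<in>F. \<bar>f a - f x\<bar> < e))"
proof -
  \<comment> \<open>A \<open>k\<close>-tuple from \<open>K\<close> is coded by a sequence in
    \<open>K\<close> of which only the first \<open>k\<close> entries matter.\<close>
  define W where "W a = {g :: nat \<Rightarrow> 'a \<Rightarrow> real. \<forall>i\<in>{..<k}. \<bar>g i a - g i x\<bar> < e}" for a
  have "compact {g :: nat \<Rightarrow> 'a \<Rightarrow> real. \<forall>i. g i \<in> K}"
    using K by (rule compact_pointwise)
  moreover have "open (W a)" for a
  proof -
    have ev: "continuous_on UNIV (\<lambda>g :: nat \<Rightarrow> 'a \<Rightarrow> real. g i z)" for i z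
      by (rule continuous_on_compose2[where t = UNIV and g = "\<lambda>h. h z" and f = "\<lambda>g. g i"]) auto
    have "W a = (\<Inter>i\<in>{..<k}. {g. \<bar>g i a - g i x\<bar> < e})" by (auto simp: W_def)
    also have "open \<dots>"
      by (intro open_INT ballI open_Collect_less continuous_intros ev) simp
    finally show ?thesis .
  qed
  moreover have "{g :: nat \<Rightarrow> 'a \<Rightarrow> real. \<forall>i. g i \<in> K} \<subseteq> (\<Union>a\<in>A. W a)"
  proof
    fix g :: "nat \<Rightarrow> 'a \<Rightarrow> real" assume "g \<in> {g. \<forall>i. g i \<in> K}"
    then have "\<exists>a\<in>A. \<forall>f\<in>g ` {..<k}. \<bar>f a - f x\<bar> < e"
      by (intro approx) auto
    then show "g \<in> (\<Union>a\<in>A. W a)" by (auto simp: W_def)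
  qed
  ultimately obtain A' where A': "A' \<subseteq> A" "finite A'"
    "{g :: nat \<Rightarrow> 'a \<Rightarrow> real. \<forall>i. g i \<in> K} \<subseteq> (\<Union>a\<in>A'. W a)"
    by (rule compactE_image)
  \<comment> \<open>A nonempty \<open>F\<close> is enumerated and padded with \<open>f0\<close>. For
    an empty \<open>F\<close> nothing is available for padding, and the extra point \<open>b\<close>
    is the witness.\<close>
  have ne: "\<exists>a\<in>insert b A'. \<forall>f\<in>F. \<bar>f a - f x\<bar> < e"
    if F: "finite F" "card F \<le> k" "F \<subseteq> K" for F b
  proof (cases "F = {}")
    case False
    then obtain f0 where "f0 \<in> F" by blast
    obtain h where h: "bij_betw h {..<card F} F"
      using ex_bij_betw_nat_finite[OF F(1)] by (auto simp: atLeast0LessThan)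
    define g where "g i = (if i < card F then h i else f0)" for i
    have "g i \<in> F" for i
      using h \<open>f0 \<in> F\<close> by (auto simp: g_def bij_betw_def)
    then have "g \<in> {g. \<forall>i. g i \<in> K}" using F(3) by auto
    then obtain a where a: "a \<in> A'" "g \<in> W a" using A'(3) by blast
    have "\<bar>f a - f x\<bar> < e" if "f \<in> F" for f
    proof -
      have "f \<in> h ` {..<card F}" using h that by (simp add: bij_betw_def)
      then obtain i where "i < card F" "f = h i" by blast
      moreover have "\<bar>g i a - g i x\<bar> < e"
        using a(2) F(2) \<open>i < card F\<close> by (simp add: W_def)
      ultimately show ?thesis by (simp add: g_def)
    qed
    with a(1) show ?thesis by blast
  qed auto
  obtain b where "b \<in> A" using approx[of "{}"] by auto
  with ne A' show ?thesis
    by (intro exI[of _ "insert b A'"]) auto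
qed

section \<open>Sequences equivalent to the unit vectors of \<open>\<ell>\<^sub>1\<close>\<close>

lemma l10_diff: "a \<in> l10 \<Longrightarrow> b \<in> l10 \<Longrightarrow> (\<lambda>i. a i - b i) \<in> l10"
  by (auto simp: l10_def intro: finite_subset[of _ "{i. a i \<noteq> 0} \<union> {i. b i \<noteq> 0}"])

lemma T0_diff:
  assumes "a \<in> l10" "b \<in> l10"
  shows "T0 y (\<lambda>i. a i - b i) = T0 y a - T0 y b"
proof -
  have "(\<lambda>i. - 1 * b i) \<in> l10" using assms(2) by (simp add: l10_def)
  from T0_add[OF assms(1) this, of y] T0_scale[OF assms(2), of y "-1"] show ?thesis by simp
qed

lemma convex_symmetric_sum_in:
  fixes V :: "'a::real_vector set"
  assumes V: "convex V" "0 \<in> V" "\<And>v. v \<in> V \<Longrightarrow> - v \<in> V"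
    and I: "finite I" "\<And>i. i \<in> I \<Longrightarrow> v i \<in> V" and le: "(\<Sum>i\<in>I. \<bar>c i\<bar>) \<le> 1"
  shows "(\<Sum>i\<in>I. c i *\<^sub>R v i) \<in> V"
proof -
  define S where "S = (\<Sum>i\<in>I. \<bar>c i\<bar>)"
  have "S \<ge> 0" by (simp add: S_def sum_nonneg)
  show ?thesis
  proof (cases "S = 0")
    case True
    then have "\<forall>i\<in>I. c i = 0" using I(1) by (simp add: S_def sum_nonneg_eq_0_iff)
    then show ?thesis using V(2) by simp
  next
    case False
    with \<open>S \<ge> 0\<close> have "S > 0" by simp
    define w where "w i = (if c i \<ge> 0 then v i else - v i)" for i
    have w: "(\<Sum>i\<in>I. (\<bar>c i\<bar> / S) *\<^sub>R w i) \<in> V"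
    proof (rule convex_sum[OF I(1) V(1)])
      show "(\<Sum>i\<in>I. \<bar>c i\<bar> / S) = 1"
        using False by (simp add: S_def sum_divide_distrib[symmetric])
    qed (use V(3) I(2) \<open>S > 0\<close> in \<open>auto simp: w_def\<close>)
    have "S *\<^sub>R (\<Sum>i\<in>I. (\<bar>c i\<bar> / S) *\<^sub>R w i) = (\<Sum>i\<in>I. c i *\<^sub>R v i)"
      unfolding scaleR_sum_right using False by (intro sum.cong) (auto simp: w_def)
    moreover have "(1 - S) *\<^sub>R 0 + S *\<^sub>R (\<Sum>i\<in>I. (\<bar>c i\<bar> / S) *\<^sub>R w i) \<in> V"
      using le \<open>S \<ge> 0\<close> w V(1,2) unfolding S_def[symmetric] convex_alt by blast
    ultimately show ?thesis by simp
  qed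
qed

lemma symmetric_convex_neighbourhood:
  fixes U :: "'a::locally_convex_space set"
  assumes "open U" "0 \<in> U"
  shows "\<exists>V. open V \<and> 0 \<in> V \<and> V \<subseteq> U \<and> convex V \<and> (\<forall>v\<in>V. - v \<in> V)"
proof -
  obtain W where W: "open W" "0 \<in> W" "W \<subseteq> U" "convex W"
    using convex_base_at_0[OF assms] by blast
  have "open {y. (- 1) *\<^sub>R (y - 0) \<in> W}" by (rule open_affine_vimage[OF W(1)])
  moreover have "convex {y. - y \<in> W}"
    using convex_linear_vimage[OF linear_uminus W(4)] by (simp add: vimage_def)
  ultimately show ?thesis
    using W by (intro exI[of _ "W \<inter> {y. - y \<in> W}"]) (auto intro: convex_Int)
qed

text \<open>Boundedness gives continuity: if all \<open>y i\<close> lie in \<open>t\<close> times an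
  absolutely convex \<open>W\<close>, then \<open>T0 y\<close> maps differences of norm less than
  \<open>1 / t\<close> into \<open>W\<close>. The lower bound on the polar gives injectivity and
  openness.\<close>

lemma l1_sequenceI:
  fixes y :: "nat \<Rightarrow> 'a::locally_convex_space"
  assumes bdd: "tvs_bounded (range y)" and V: "open V" and "0 < \<delta>"
    and lower: "\<And>a. a \<in> l10 \<Longrightarrow> \<exists>t\<in>polar V. \<delta> * l1_norm a \<le> \<bar>t (T0 y a)\<bar>"
    and "0 \<in> V"
  shows "l1_sequence y"
proof -
  interpret l: Metric_space l10 l1_dist by (rule Metric_space_l10)
  let ?Y = "top_of_set (T0 y ` l10)"
  have top: "l10_topology = l.mtopology" by (simp add: l10_topology_def)
  \<comment> \<open>Quantitative continuity of the inverse: a difference of images in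
    \<open>c\<close> times \<open>V\<close> is at most \<open>c\<close> at every functional of the
    polar.\<close>
  have small: "l1_dist a b \<le> c / \<delta>"
    if ab: "a \<in> l10" "b \<in> l10" and "0 < c" and V: "(1 / c) *\<^sub>R (T0 y a - T0 y b) \<in> V" for a b c
  proof -
    obtain t where t: "t \<in> polar V" "\<delta> * l1_dist a b \<le> \<bar>t (T0 y (\<lambda>i. a i - b i))\<bar>"
      using lower[OF l10_diff[OF ab]] unfolding l1_dist_def by blast
    then have "\<delta> * l1_dist a b \<le> c"
      using polar_scaleR_bound[OF t(1) V] \<open>0 < c\<close> T0_diff[OF ab, of y] by simp
    then show ?thesis using \<open>0 < \<delta>\<close> by (simp add: field_simps)
  qed
  have "inj_on (T0 y) l10"
  proof (rule inj_onI)
    fix a b assume ab: "a \<in> l10" "b \<in> l10" "T0 y a = T0 y b"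
    have "l1_dist a b \<le> c" if "c > 0" for c
      using small[OF ab(1,2), of "c * \<delta>"] ab(3) \<open>0 \<in> V\<close> \<open>0 < \<delta>\<close> that by simp
    then have "l1_dist a b \<le> 0" by (rule field_le_epsilon[of _ 0, simplified])
    then show "a = b" using l.nonneg[of a b] ab l.zero by simp
  qed
  moreover have "continuous_map l10_topology ?Y (T0 y)"
  proof -
    have "openin l10_topology {a \<in> topspace l10_topology. T0 y a \<in> U}" if "open U" for U
      unfolding top l.openin_mtopology
    proof (intro conjI allI impI)
      fix a assume "a \<in> {a \<in> topspace l.mtopology. T0 y a \<in> U}"
      then have a: "a \<in> l10" "T0 y a \<in> U" by auto
      have "open {w. 1 *\<^sub>R (w - (- T0 y a)) \<in> U}"
        by (rule open_affine_vimage[OF that])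
      moreover have "0 \<in> {w. 1 *\<^sub>R (w - (- T0 y a)) \<in> U}" using a(2) by simp
      ultimately obtain W where W: "open W" "0 \<in> W" "W \<subseteq> {w. 1 *\<^sub>R (w - (- T0 y a)) \<in> U}"
        "convex W" "\<And>v. v \<in> W \<Longrightarrow> - v \<in> W"
        using symmetric_convex_neighbourhood by metis
      obtain s where s: "s > 0" "\<And>t. t > s \<Longrightarrow> range y \<subseteq> (\<lambda>u. t *\<^sub>R u) ` W"
        using bdd W(1,2) unfolding tvs_bounded_def by blast
      define t where "t = s + 1"
      have "t > 0" using s(1) by (simp add: t_def)
      have "range y \<subseteq> (\<lambda>u. t *\<^sub>R u) ` W" using s(2)[of t] by (simp add: t_def)
      then have "\<forall>i. \<exists>u\<in>W. y i = t *\<^sub>R u" by blast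
      then obtain u where u: "\<And>i. u i \<in> W" "\<And>i. y i = t *\<^sub>R u i" by metis
      have "T0 y b \<in> U" if b: "b \<in> l10" "l1_dist a b < 1 / t" for b
      proof -
        define c where "c = (\<lambda>i. b i - a i)"
        have fin: "finite {i. c i \<noteq> 0}"
          using l10_diff[OF b(1) a(1)] by (simp add: l10_def c_def)
        have "l1_norm c = l1_dist a b"
          using l.commute[of a b] by (simp add: l1_dist_def c_def)
        then have "(\<Sum>i | c i \<noteq> 0. \<bar>c i * t\<bar>) \<le> 1"
          using b(2) \<open>t > 0\<close> unfolding l1_norm_def[of c] abs_mult sum_distrib_right[symmetric]
          by (simp add: field_simps)
        then have "(\<Sum>i | c i \<noteq> 0. (c i * t) *\<^sub>R u i) \<in> W"
          using fin u(1) W by (intro convex_symmetric_sum_in) auto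
        moreover have "(\<Sum>i | c i \<noteq> 0. (c i * t) *\<^sub>R u i) = T0 y c"
          by (simp add: T0_def u(2))
        moreover have "T0 y c = T0 y b - T0 y a"
          unfolding c_def by (rule T0_diff[OF b(1) a(1)])
        ultimately show ?thesis using W(3) by auto
      qed
      then show "\<exists>r>0. l.mball a r \<subseteq> {a \<in> topspace l.mtopology. T0 y a \<in> U}"
        using \<open>t > 0\<close> by (intro exI[of _ "1 / t"]) auto
    qed auto
    then have "continuous_map l10_topology euclidean (T0 y)"
      by (simp add: continuous_map_def)
    then show ?thesis
      by (simp add: continuous_map_in_subtopology top)
  qed
  moreover have "open_map l10_topology ?Y (T0 y)"
    unfolding open_map_def
  proof (intro allI impI)
    fix U assume "openin l10_topology U"
    then have U: "U \<subseteq> l10" "\<And>a. a \<in> U \<Longrightarrow> \<exists>r>0. l.mball a r \<subseteq> U"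
      unfolding top l.openin_mtopology by auto
    show "openin ?Y (T0 y ` U)"
    proof (subst openin_subopen, intro ballI)
      fix p assume "p \<in> T0 y ` U"
      then obtain a where a: "a \<in> U" "p = T0 y a" by blast
      obtain r where r: "r > 0" "l.mball a r \<subseteq> U" using U(2)[OF a(1)] by blast
      \<comment> \<open>Chosen so that \<open>c / \<delta> = r / 2\<close>, strictly below
        \<open>r\<close>.\<close>
      define c where "c = r * \<delta> / 2"
      have "c > 0" "c / \<delta> < r" using r(1) \<open>0 < \<delta>\<close> by (auto simp: c_def field_simps)
      define W where "W = {w. (1 / c) *\<^sub>R (w - T0 y a) \<in> V}"
      have "open W" unfolding W_def by (rule open_affine_vimage[OF V])
      moreover have "p \<in> W" using a(2) \<open>0 \<in> V\<close> by (simp add: W_def)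
      moreover have "T0 y ` l10 \<inter> W \<subseteq> T0 y ` U"
      proof
        fix q assume "q \<in> T0 y ` l10 \<inter> W"
        then obtain b where b: "b \<in> l10" "q = T0 y b" "(1 / c) *\<^sub>R (T0 y b - T0 y a) \<in> V"
          by (auto simp: W_def)
        have "a \<in> l10" using a(1) U(1) by blast
        have "l1_dist b a \<le> c / \<delta>"
          using small[OF b(1) \<open>a \<in> l10\<close> \<open>c > 0\<close> b(3)] .
        then have "b \<in> l.mball a r"
          using b(1) \<open>a \<in> l10\<close> \<open>c / \<delta> < r\<close> by (simp add: l.commute)
        with r(2) b(2) show "q \<in> T0 y ` U" by blast
      qed
      ultimately show "\<exists>T. openin ?Y T \<and> p \<in> T \<and> T \<subseteq> T0 y ` U"
        using a U(1) by (intro exI[of _ "T0 y ` l10 \<inter> W"]) (auto intro: openin_open_Int)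
    qed
  qed
  ultimately show ?thesis
    unfolding l1_sequence_def
    by (intro bijective_open_imp_homeomorphic_map) (simp_all add: top)
qed

text \<open>Let \<open>t\<close> realise the sign pattern of \<open>a\<close> and \<open>u\<close>
  the opposite one. Each term of \<open>t (T0 y a) - u (T0 y a)\<close> is at least
  \<open>(s - r) * \<bar>a i\<bar>\<close>, whatever the signs of \<open>r\<close> and
  \<open>s\<close>, so one of the two functionals attains half of the total in absolute
  value.\<close>

lemma independent_on_l1_lower_bound:
  fixes y :: "nat \<Rightarrow> 'a::real_vector"
  assumes ind: "independent_on K (\<lambda>i t. t (y i) \<ge> s) (\<lambda>i t. t (y i) \<le> r)"
    and lin: "\<And>t. t \<in> K \<Longrightarrow> linear t" and a: "a \<in> l10"
  shows "\<exists>t\<in>K. (s - r) / 2 * l1_norm a \<le> \<bar>t (T0 y a)\<bar>"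
proof -
  let ?I = "{i. a i \<noteq> 0}"
  have "finite ?I" using a by (simp add: l10_def)
  then obtain N where N: "\<forall>i\<in>?I. i < N" using finite_nat_set_iff_bounded by blast
  have "\<exists>t\<in>K. \<forall>i<N. if i \<in> P then t (y i) \<ge> s else t (y i) \<le> r" for P
    using ind unfolding independent_on_def by blast
  then obtain \<tau> where \<tau>: "\<And>P. \<tau> P \<in> K"
    "\<And>P i. i < N \<Longrightarrow> if i \<in> P then \<tau> P (y i) \<ge> s else \<tau> P (y i) \<le> r"
    by metis
  define t where "t = \<tau> {i. a i > 0}"
  define u where "u = \<tau> {i. \<not> a i > 0}"
  have lin_sum: "f (T0 y a) = (\<Sum>i\<in>?I. a i * f (y i))" if "f \<in> K" for f
    using lin[OF that] by (simp add: T0_def linear_sum linear_scale)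
  have "(s - r) * l1_norm a = (\<Sum>i\<in>?I. \<bar>a i\<bar> * (s - r))"
    by (simp add: l1_norm_def sum_distrib_left mult.commute)
  also have "\<dots> \<le> (\<Sum>i\<in>?I. a i * (t (y i) - u (y i)))"
  proof (rule sum_mono)
    fix i assume i: "i \<in> ?I"
    show "\<bar>a i\<bar> * (s - r) \<le> a i * (t (y i) - u (y i))"
    proof (cases "a i > 0")
      case True
      then have "s - r \<le> t (y i) - u (y i)"
        using \<tau>(2)[of i "{i. a i > 0}"] \<tau>(2)[of i "{i. \<not> a i > 0}"] N i
        by (simp add: t_def u_def)
      with True show ?thesis by simp
    next
      case False
      with i have "s - r \<le> u (y i) - t (y i)"
        using \<tau>(2)[of i "{i. a i > 0}"] \<tau>(2)[of i "{i. \<not> a i > 0}"] N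
        by (simp add: t_def u_def)
      then have "- a i * (s - r) \<le> - a i * (u (y i) - t (y i))"
        using False by (intro mult_left_mono) auto
      with False show ?thesis by (simp add: algebra_simps)
    qed
  qed
  also have "\<dots> = t (T0 y a) - u (T0 y a)"
    by (simp add: lin_sum t_def u_def \<tau>(1) sum_subtractf algebra_simps)
  finally have "(s - r) / 2 * l1_norm a \<le> \<bar>t (T0 y a)\<bar> \<or> (s - r) / 2 * l1_norm a \<le> \<bar>u (T0 y a)\<bar>"
    by (simp add: field_simps) linarith
  then show ?thesis using \<tau>(1) unfolding t_def u_def by blast
qed

lemma tvs_bounded_subset: "tvs_bounded C \<Longrightarrow> D \<subseteq> C \<Longrightarrow> tvs_bounded D"
  unfolding tvs_bounded_def by (meson order_trans)

text \<open>Rosenthal's theorem on one polar: an independent sequence taken from \<open>y\<close>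
  would be an \<open>\<ell>\<^sub>1\<close>-sequence in \<open>C\<close>.\<close>

lemma no_l1_sequence_convergent_subsequence:
  fixes y :: "nat \<Rightarrow> 'a::locally_convex_space"
  assumes bdd: "tvs_bounded C" and no: "\<nexists>x :: nat \<Rightarrow> 'a. range x \<subseteq> C \<and> l1_sequence x"
    and V: "open V" "0 \<in> V" and y: "range y \<subseteq> C"
  shows "\<exists>g. strict_mono g \<and> (\<forall>t\<in>polar V. convergent (\<lambda>n. t (y (g n))))"
proof -
  obtain B where B: "\<And>t c. t \<in> polar V \<Longrightarrow> c \<in> C \<Longrightarrow> \<bar>t c\<bar> \<le> B"
    using tvs_bounded_polar[OF bdd V] by blast
  have "\<exists>b. \<forall>n. \<bar>t (y n)\<bar> \<le> b" if "t \<in> polar V" for t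
    using B[OF that] y by blast
  then show ?thesis
  proof (rule rosenthal_dichotomy)
    fix e r s
    assume independent: "r < s" "independent_on (polar V) (\<lambda>i t. t (y (e i)) \<ge> s) (\<lambda>i t. t (y (e i)) \<le> r)"
    have "l1_sequence (\<lambda>i. y (e i))"
    proof (rule l1_sequenceI[OF _ V(1) _ _ V(2)])
      show "tvs_bounded (range (\<lambda>i. y (e i)))"
        using y by (intro tvs_bounded_subset[OF bdd]) auto
      show "0 < (s - r) / 2" using independent(1) by simp
      show "\<exists>t\<in>polar V. (s - r) / 2 * l1_norm a \<le> \<bar>t (T0 (\<lambda>i. y (e i)) a)\<bar>" if "a \<in> l10" for a
        using independent_on_l1_lower_bound[OF independent(2) polar_linear that] .
    qed
    moreover have "range (\<lambda>i. y (e i)) \<subseteq> C" using y by auto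
    ultimately show ?thesis using no by blast
  next
    fix g :: "nat \<Rightarrow> nat"
    assume "strict_mono g" "\<And>t. t \<in> polar V \<Longrightarrow> convergent (\<lambda>n. t (y (g n)))"
    then show ?thesis by auto
  qed
qed

section \<open>The weak closure of the differences\<close>

text \<open>
  The seminorm \<open>p z = \<Lambda> (\<lambda>t. \<bar>t z\<bar>)\<close> of a mean separating \<open>b\<close> is a supremum of weakly continuous
  functionals \<open>z \<mapsto> \<Lambda> (\<lambda>t. sgn (t w) * t z)\<close>, so its balls are weakly closed and the weak closure of
  the \<open>p\<close>-totally bounded set \<open>C - C\<close> is covered by finitely many of them.
\<close>
lemma weak_closure_differences_not_independent:
  fixes C :: "'a::locally_convex_space set"
  assumes bdd: "tvs_bounded C" and no: "\<nexists>x :: nat \<Rightarrow> 'a. range x \<subseteq> C \<and> l1_sequence x"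
    and V: "open V" "0 \<in> V"
    and b: "\<And>i. b i \<in> weak_topology closure_of {x - y | x y. x \<in> C \<and> y \<in> C}" and "r < s"
  shows "\<not> independent_on (polar V) (\<lambda>i t. t (b i) - t x \<ge> s) (\<lambda>i t. t (b i) - t x \<le> r)"
proof
  assume ind: "independent_on (polar V) (\<lambda>i t. t (b i) - t x \<ge> s) (\<lambda>i t. t (b i) - t x \<le> r)"
  have ev: "bounded_fun_on (polar V) (\<lambda>t. t z)" for z
  proof -
    obtain c where "c > 0" "c *\<^sub>R z \<in> V" using open_absorbing[OF V] by blast
    then show ?thesis
      by (intro bounded_fun_onI[of _ _ "1 / c"]) (rule polar_scaleR_bound)
  qed
  obtain \<Lambda> where \<Lambda>: "mean (polar V) \<Lambda>"
    "\<And>i j. i \<noteq> j \<Longrightarrow> (s - r) / 4 \<le> \<Lambda> (\<lambda>t. \<bar>(t (b i) - t x) - (t (b j) - t x)\<bar>)"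
    using independent_on_separating_mean[OF _ ind \<open>r < s\<close>] bounded_fun_on_diff[OF ev ev] by blast
  interpret mean "polar V" \<Lambda> by fact
  define p where "p z = \<Lambda> (\<lambda>t. \<bar>t z\<bar>)" for z
  define \<phi> where "\<phi> w z = \<Lambda> (\<lambda>t. sgn (t w) * t z)" for w z
  have b\<phi>: "bounded_fun_on (polar V) (\<lambda>t. sgn (t w) * t z)" for w z
    by (intro bounded_fun_on_intros ev)
  have p_cong: "\<Lambda> f = \<Lambda> g" if "\<And>t. t \<in> polar V \<Longrightarrow> f t = g t" "bounded_fun_on (polar V) f"
    "bounded_fun_on (polar V) g" for f g
    using that by (intro antisym mono) auto
  have p_triangle: "p (x + y) \<le> p x + p y" for x y
  proof -
    have "p (x + y) \<le> \<Lambda> (\<lambda>t. \<bar>t x\<bar> + \<bar>t y\<bar>)"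
      unfolding p_def
    proof (rule mono)
      show "\<bar>t (x + y)\<bar> \<le> \<bar>t x\<bar> + \<bar>t y\<bar>" if "t \<in> polar V" for t
        using polar_linear[OF that] abs_triangle_ineq by (simp add: linear_add)
    qed (intro bounded_fun_on_intros ev)+
    then show ?thesis
      unfolding p_def by (subst (asm) add) (intro bounded_fun_on_intros ev)+
  qed
  have p_minus: "p (- x) = p x" for x
    unfolding p_def
    by (rule p_cong) (auto simp: linear_neg polar_linear intro!: bounded_fun_on_intros ev)
  have \<phi>_le_p: "\<phi> w z \<le> p z" for w z
    unfolding \<phi>_def p_def
    by (rule mono[OF b\<phi> bounded_fun_on_abs[OF ev]]) (auto simp: sgn_if)
  have \<phi>_self: "\<phi> w w = p w" for w
    unfolding \<phi>_def p_def
    by (rule p_cong[OF _ b\<phi> bounded_fun_on_abs[OF ev]]) (simp add: sgn_if)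
  have \<phi>_add: "\<phi> w (x + y) = \<phi> w x + \<phi> w y" for w x y
  proof -
    have "\<phi> w (x + y) = \<Lambda> (\<lambda>t. sgn (t w) * t x + sgn (t w) * t y)"
      unfolding \<phi>_def
      by (rule p_cong) (auto simp: linear_add polar_linear distrib_left intro!: bounded_fun_on_add b\<phi>)
    then show ?thesis by (simp add: add[OF b\<phi> b\<phi>] \<phi>_def)
  qed
  have \<phi>_scale: "\<phi> w (c *\<^sub>R x) = c * \<phi> w x" for w c x
  proof -
    have "\<phi> w (c *\<^sub>R x) = \<Lambda> (\<lambda>t. c * (sgn (t w) * t x))"
      unfolding \<phi>_def
      by (rule p_cong) (auto simp: linear_scale polar_linear intro!: bounded_fun_on_mult bounded_fun_on_const b\<phi>)
    then show ?thesis by (simp add: cmult[OF b\<phi>] \<phi>_def)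
  qed
  have \<phi>_linear: "linear (\<phi> w)" for w
    by (rule linearI) (simp_all add: \<phi>_add \<phi>_scale)
  have p_V: "p v \<le> 1" if "v \<in> V" for v
  proof -
    have "p v \<le> \<Lambda> (\<lambda>_. 1)"
      unfolding p_def using that by (intro mono bounded_fun_on_intros ev) (simp add: polar_def)
    then show ?thesis by (simp add: one)
  qed
  \<comment> \<open>Domination by \<open>p\<close>, which is at most \<open>1\<close> on
    \<open>V\<close>, puts \<open>\<phi> w\<close> into the same polar and hence into the
    dual.\<close>
  have "\<phi> w \<in> polar V" for w
  proof -
    have "\<bar>\<phi> w v\<bar> \<le> 1" if "v \<in> V" for v
      using \<phi>_le_p[of w v] \<phi>_le_p[of w "- v"] p_V[OF that] linear_neg[OF \<phi>_linear, of w v]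
      by (simp add: p_minus abs_le_iff)
    then show ?thesis by (simp add: polar_def \<phi>_linear)
  qed
  then have \<phi>_dual: "\<phi> w \<in> topological_dual" for w
    using polar_subset_dual[OF V] by blast
  \<comment> \<open>Two points within \<open>2 * \<delta>\<close> of the same centre are at distance
    at most \<open>(s - r) / 5\<close>, less than the separation \<open>(s - r) / 4\<close>.\<close>
  define \<delta> where "\<delta> = (s - r) / 20"
  have "\<delta> > 0" using \<open>r < s\<close> by (simp add: \<delta>_def)
  obtain B where B: "\<And>t c. t \<in> polar V \<Longrightarrow> c \<in> C \<Longrightarrow> \<bar>t c\<bar> \<le> B"
    using tvs_bounded_polar[OF bdd V] by blast
  have "\<exists>F. finite F \<and> F \<subseteq> C \<and> (\<forall>c\<in>C. \<exists>f\<in>F. p (c - f) < \<delta>)"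
    unfolding p_def
  proof (rule mean_totally_bounded[OF \<Lambda>(1) compact_polar[OF V]])
    show "\<exists>g. strict_mono g \<and> (\<forall>t\<in>polar V. convergent (\<lambda>n. t (y (g n))))"
      if "range y \<subseteq> C" for y :: "nat \<Rightarrow> 'a"
      using no_l1_sequence_convergent_subsequence[OF bdd no V that] .
  qed (use B polar_linear \<open>\<delta> > 0\<close> in auto)
  then obtain F where F: "finite F" "F \<subseteq> C" "\<And>c. c \<in> C \<Longrightarrow> \<exists>f\<in>F. p (c - f) < \<delta>"
    by blast
  define G where "G = (\<lambda>(f, g). f - g) ` (F \<times> F)"
  have "finite G" using F(1) by (simp add: G_def)
  have cover: "\<exists>w\<in>G. p (z - w) \<le> 2 * \<delta>"
    if z: "z \<in> weak_topology closure_of {x - y | x y. x \<in> C \<and> y \<in> C}" for z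
  proof (rule ccontr)
    assume "\<not> ?thesis"
    then have far: "\<And>w. w \<in> G \<Longrightarrow> 2 * \<delta> < p (z - w)" by auto
    \<comment> \<open>The least excess of \<open>z\<close> over the finitely many balls; the entry
      \<open>1\<close> covers an empty \<open>G\<close>.\<close>
    define e where "e = Min (insert 1 ((\<lambda>w. p (z - w) - 2 * \<delta>) ` G))"
    have "e > 0"
      using \<open>finite G\<close> far by (simp add: e_def)
    have e: "e \<le> p (z - w) - 2 * \<delta>" if "w \<in> G" for w
      using \<open>finite G\<close> that by (simp add: e_def)
    \<comment> \<open>For each centre \<open>w\<close> the functional \<open>\<phi> (z - w)\<close>
      norms \<open>z - w\<close>. A difference \<open>c - d\<close> close to \<open>z\<close> at all
      of them would be outside every ball, but \<open>C - C\<close> is covered by the balls.\<close>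
    have dual: "(\<lambda>w. \<phi> (z - w)) ` G \<subseteq> topological_dual" using \<phi>_dual by blast
    obtain c d where cd: "c \<in> C" "d \<in> C"
      "\<And>w. w \<in> G \<Longrightarrow> \<bar>\<phi> (z - w) (c - d) - \<phi> (z - w) z\<bar> < e"
      using weak_closure_of_approx[OF z finite_imageI[OF \<open>finite G\<close>] dual \<open>e > 0\<close>] by auto
    obtain f g where fg: "f \<in> F" "g \<in> F" "p (c - f) < \<delta>" "p (d - g) < \<delta>"
      using F(3) cd(1,2) by blast
    define w where "w = f - g"
    have w: "w \<in> G" using fg(1,2) by (auto simp: w_def G_def)
    have "p ((c - d) - w) = p ((c - f) + - (d - g))" by (simp add: w_def algebra_simps)
    also have "\<dots> \<le> p (c - f) + p (d - g)"
      using p_triangle[of "c - f" "- (d - g)"] by (simp only: p_minus)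
    finally have "p ((c - d) - w) < 2 * \<delta>" using fg(3,4) by simp
    with \<phi>_le_p[of "z - w" "(c - d) - w"] have "\<phi> (z - w) ((c - d) - w) < 2 * \<delta>" by simp
    moreover have "\<phi> (z - w) ((c - d) - w) = \<phi> (z - w) (c - d) - \<phi> (z - w) w"
      by (rule linear_diff[OF \<phi>_linear])
    moreover have "p (z - w) = \<phi> (z - w) z - \<phi> (z - w) w"
      using \<phi>_self[of "z - w"] linear_diff[OF \<phi>_linear, of "z - w" z w] by simp
    ultimately show False
      using cd(3)[OF w] e[OF w] by linarith
  qed
  then have "\<forall>i. \<exists>w\<in>G. p (b i - w) \<le> 2 * \<delta>" using b by blast
  then obtain h where h: "\<And>i. h i \<in> G" "\<And>i. p (b i - h i) \<le> 2 * \<delta>" by metis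
  have "\<not> inj h"
  proof
    assume "inj h"
    then have "finite (UNIV :: nat set)"
      using \<open>finite G\<close> h(1) by (meson finite_imageD finite_subset image_subsetI)
    then show False by simp
  qed
  then obtain i j where ij: "i \<noteq> j" "h i = h j" by (auto simp: inj_def)
  have "p (b i - b j) = p ((b i - h i) + - (b j - h j))" using ij(2) by simp
  also have "\<dots> \<le> p (b i - h i) + p (b j - h j)"
    using p_triangle[of "b i - h i" "- (b j - h j)"] by (simp only: p_minus)
  also have "\<dots> \<le> 4 * \<delta>" using h(2)[of i] h(2)[of j] by simp
  finally have "p (b i - b j) \<le> (s - r) / 5" by (simp add: \<delta>_def)
  moreover have "p (b i - b j) = \<Lambda> (\<lambda>t. \<bar>(t (b i) - t x) - (t (b j) - t x)\<bar>)"
    unfolding p_def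
    by (rule p_cong) (auto simp: linear_diff polar_linear intro!: bounded_fun_on_intros ev)
  ultimately show False
    using \<Lambda>(2)[OF ij(1)] \<open>r < s\<close> by simp
qed

section \<open>Extraction of a weakly convergent sequence\<close>

text \<open>For each \<open>m\<close> finitely many points of \<open>A\<close> handle all sets of at
  most \<open>m\<close> functionals in the polar of \<open>V m\<close> with error
  \<open>1 / Suc m\<close>. The polars increase with \<open>m\<close>, so one large \<open>m\<close>
  accommodates a given finite set of functionals, its size and the required error.\<close>

lemma weak_closure_countable_tightness:
  fixes A :: "'a::topological_real_vector set" and V :: "nat \<Rightarrow> 'a set"
  assumes V: "\<And>n. open (V n)" "\<And>n. 0 \<in> V n" "decseq V"
    and base: "\<And>U. open U \<Longrightarrow> 0 \<in> U \<Longrightarrow> \<exists>n. V n \<subseteq> U"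
    and x: "x \<in> weak_topology closure_of A"
  obtains a :: "nat \<Rightarrow> 'a" where "range a \<subseteq> A"
    "\<And>F e. finite F \<Longrightarrow> F \<subseteq> topological_dual \<Longrightarrow> 0 < e \<Longrightarrow> \<exists>n. \<forall>f\<in>F. \<bar>f (a n) - f x\<bar> < e"
proof -
  have "\<exists>A'. finite A' \<and> A' \<subseteq> A \<and> (\<forall>F. finite F \<longrightarrow> card F \<le> m \<longrightarrow> F \<subseteq> polar (V m) \<longrightarrow>
      (\<exists>a\<in>A'. \<forall>f\<in>F. \<bar>f a - f x\<bar> < 1 / Suc m))" for m
  proof (rule compact_finite_approx[OF compact_polar[OF V(1,2)]])
    fix F assume "finite F" "F \<subseteq> polar (V m)"
    then show "\<exists>a\<in>A. \<forall>f\<in>F. \<bar>f a - f x\<bar> < 1 / Suc m"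
      using polar_subset_dual[OF V(1,2)] by (intro weak_closure_of_approx[OF x]) auto
  qed
  then obtain A' where A': "\<And>m. finite (A' m)" "\<And>m. A' m \<subseteq> A"
    "\<And>m F. finite F \<Longrightarrow> card F \<le> m \<Longrightarrow> F \<subseteq> polar (V m) \<Longrightarrow> \<exists>a\<in>A' m. \<forall>f\<in>F. \<bar>f a - f x\<bar> < 1 / Suc m"
    by metis
  define D where "D = (\<Union>m. A' m)"
  have "countable D" unfolding D_def using A'(1) by (auto intro: countable_finite)
  moreover have "D \<noteq> {}" using A'(3)[of "{}" 0] by (auto simp: D_def)
  ultimately have rD: "range (from_nat_into D) = D" by (rule range_from_nat_into[rotated])
  show ?thesis
  proof (rule that)
    show "range (from_nat_into D) \<subseteq> A" unfolding rD using A'(2) by (auto simp: D_def)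
    fix F :: "('a \<Rightarrow> real) set" and e :: real
    assume F: "finite F" "F \<subseteq> topological_dual" and "0 < e"
    obtain k where k: "\<And>f. f \<in> F \<Longrightarrow> f \<in> polar (V (k f))"
      using dual_in_polar[OF _ base] F(2) by (metis subsetD)
    obtain l where l: "1 / Suc l < e" using nat_approx_posE[OF \<open>0 < e\<close>] by blast
    define m where "m = Max (insert l (insert (card F) (k ` F)))"
    have m: "l \<le> m" "card F \<le> m" "\<And>f. f \<in> F \<Longrightarrow> k f \<le> m"
      unfolding m_def using F(1) by (auto intro!: Max_ge simp del: Max_insert)
    have "F \<subseteq> polar (V m)"
      using k polar_anti_mono[OF decseqD[OF V(3) m(3)]] by blast
    then obtain a where a: "a \<in> A' m" "\<And>f. f \<in> F \<Longrightarrow> \<bar>f a - f x\<bar> < 1 / Suc m"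
      using A'(3)[OF F(1) m(2)] by blast
    have "1 / Suc m \<le> 1 / Suc l" using m(1) by (simp add: field_simps)
    moreover have "a \<in> range (from_nat_into D)" using a(1) unfolding rD by (auto simp: D_def)
    then obtain n where "a = from_nat_into D n" by blast
    ultimately show "\<exists>n. \<forall>f\<in>F. \<bar>f (from_nat_into D n) - f x\<bar> < e"
      using a(2) l by (meson order_less_le_trans order_less_trans)
  qed
qed

text \<open>The index sets of good approximations form a base of a proper filter, because finite
  sets of functionals are directed; any finer ultrafilter works.\<close>

lemma approximation_ultrafilter:
  fixes a :: "nat \<Rightarrow> 'a" and D :: "('a \<Rightarrow> real) set"
  assumes "\<And>F e. finite F \<Longrightarrow> F \<subseteq> D \<Longrightarrow> 0 < e \<Longrightarrow> \<exists>n. \<forall>f\<in>F. \<bar>f (a n) - f x\<bar> < e"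
  obtains U where "ultrafilter U" "\<And>f. f \<in> D \<Longrightarrow> ((\<lambda>n. f (a n) - f x) \<longlongrightarrow> 0) U"
proof -
  define I where "I = {F. finite F \<and> F \<subseteq> D} \<times> {0 :: real<..}"
  define N where "N = (\<lambda>(F :: ('a \<Rightarrow> real) set, e). {n. \<forall>f\<in>F. \<bar>f (a n) - f x\<bar> < e})"
  have base: "eventually P (INF i\<in>I. principal (N i)) \<longleftrightarrow> (\<exists>i\<in>I. eventually P (principal (N i)))" for P
  proof (rule eventually_INF_base)
    have "({}, 1) \<in> I" by (simp add: I_def)
    then show "I \<noteq> {}" by blast
    fix i j assume "i \<in> I" "j \<in> I"
    then obtain F d G e where *: "i = (F, d)" "j = (G, e)" "(F, d) \<in> I" "(G, e) \<in> I" by (metis surj_pair)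
    then have "(F \<union> G, min d e) \<in> I" by (auto simp: I_def)
    moreover have "N (F \<union> G, min d e) \<subseteq> N i \<inter> N j" by (auto simp: N_def *(1,2))
    ultimately show "\<exists>x\<in>I. principal (N x) \<le> inf (principal (N i)) (principal (N j))"
      by (intro bexI[of _ "(F \<union> G, min d e)"]) auto
  qed
  have "(INF i\<in>I. principal (N i)) \<noteq> bot"
  proof -
    have "N (F, e) \<noteq> {}" if "(F, e) \<in> I" for F e
      using assms[of F e] that by (simp add: I_def N_def)
    then show ?thesis
      unfolding trivial_limit_def base eventually_principal by fast
  qed
  from ultrafilter_exists[OF this] obtain U where
    U: "U \<le> (INF i\<in>I. principal (N i))" "ultrafilter U" by blast
  show ?thesis
  proof (rule that[OF U(2)])
    fix f assume "f \<in> D"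
    show "((\<lambda>n. f (a n) - f x) \<longlongrightarrow> 0) U"
    proof (rule tendstoI)
      fix e :: real assume "0 < e"
      have "({f}, e) \<in> I" using \<open>f \<in> D\<close> \<open>0 < e\<close> by (simp add: I_def)
      then have "\<forall>\<^sub>F n in (INF i\<in>I. principal (N i)). n \<in> N ({f}, e)"
        unfolding base by (intro bexI) (auto simp: eventually_principal)
      then have "\<forall>\<^sub>F n in U. n \<in> N ({f}, e)" by (rule filter_leD[OF U(1)])
      then show "\<forall>\<^sub>F n in U. dist (f (a n) - f x) 0 < e"
        by (rule eventually_mono) (simp add: N_def dist_real_def)
    qed
  qed
qed

lemma weak_closure_differences_sequential:
  fixes C :: "'a::locally_convex_space set"
  assumes met: "metrizable_space (euclidean :: 'a topology)" and bdd: "tvs_bounded C"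
    and no: "\<nexists>x :: nat \<Rightarrow> 'a. range x \<subseteq> C \<and> l1_sequence x"
    and A: "A \<subseteq> weak_topology closure_of {x - y | x y. x \<in> C \<and> y \<in> C}"
    and x: "x \<in> weak_topology closure_of A"
  shows "\<exists>\<xi> :: nat \<Rightarrow> 'a. range \<xi> \<subseteq> A \<and> limitin weak_topology \<xi> x sequentially"
proof -
  obtain V :: "nat \<Rightarrow> 'a set" where V: "\<And>n. open (V n)" "\<And>n. 0 \<in> V n" "decseq V"
    and base: "\<And>U. open U \<Longrightarrow> 0 \<in> U \<Longrightarrow> \<exists>n. V n \<subseteq> U"
    using metrizable_decseq_base[OF met, of 0] by blast
  obtain a :: "nat \<Rightarrow> 'a" where a: "range a \<subseteq> A"
    "\<And>F e. finite F \<Longrightarrow> F \<subseteq> topological_dual \<Longrightarrow> 0 < e \<Longrightarrow> \<exists>n. \<forall>f\<in>F. \<bar>f (a n) - f x\<bar> < e"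
    using weak_closure_countable_tightness[OF V base x] by blast
  obtain U where U: "ultrafilter U"
    "\<And>f. f \<in> topological_dual \<Longrightarrow> ((\<lambda>n. f (a n) - f x) \<longlongrightarrow> 0) U"
    using approximation_ultrafilter[OF a(2)] by blast
  have "\<exists>S. strategy U S \<and>
      (\<forall>M. follows S M \<longrightarrow> \<not> (\<exists>t\<in>polar (V m). \<forall>k. t (a (M k)) - t x \<ge> 1 / Suc m))" for m
  proof (rule not_independent_imp_small_strategy[OF U(1) compact_polar[OF V(1,2)]])
    show "continuous_on UNIV (\<lambda>t :: 'a \<Rightarrow> real. t (a n) - t x)" for n
      by (intro continuous_on_diff continuous_on_evaluation)
    show "((\<lambda>n. t (a n) - t x) \<longlongrightarrow> 0) U" if "t \<in> polar (V m)" for t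
      using U(2) that polar_subset_dual[OF V(1,2)] by blast
    show "\<not> independent_on (polar (V m)) (\<lambda>i t. 1 / Suc m \<le> t (a (e i)) - t x)
        (\<lambda>i t. t (a (e i)) - t x \<le> 1 / Suc m / 2)" for e
      using a(1) A
      by (intro weak_closure_differences_not_independent[OF bdd no V(1,2)]) (auto simp: field_simps)
  qed simp
  then obtain S where S: "\<And>m. strategy U (S m)"
    "\<And>m M t. follows (S m) M \<Longrightarrow> t \<in> polar (V m) \<Longrightarrow> \<not> (\<forall>k. t (a (M k)) - t x \<ge> 1 / Suc m)"
    by metis
  \<comment> \<open>\<open>U\<close> may be principal, for instance at an \<open>n\<close> with
    \<open>a n = x\<close>, so \<open>M\<close> is not forced to increase; a sequence of elements of
    \<open>A\<close> is all that is wanted.\<close>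
  obtain M :: "nat \<Rightarrow> nat" where
    M: "\<And>m (g :: nat \<Rightarrow> nat). strict_mono g \<Longrightarrow> m \<le> g 0 \<Longrightarrow> follows (S m) (M \<circ> g)"
    using strategies_diagonal[of U S] S(1) U(1) unfolding ultrafilter_def by metis
  have upper: "\<forall>\<^sub>F k in sequentially. t (a (M k)) - t x < e"
    if t: "t \<in> topological_dual" and "0 < e" for t e
  proof (rule ccontr)
    assume "\<not> ?thesis"
    then have inf: "\<exists>\<^sub>\<infinity>k. t (a (M k)) - t x \<ge> e"
      unfolding cofinite_eq_sequentially by (simp add: not_eventually not_less)
    obtain m where m: "t \<in> polar (V m)" using dual_in_polar[OF t base] by blast
    obtain l where l: "1 / Suc l < e" using nat_approx_posE[OF \<open>0 < e\<close>] by blast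
    \<comment> \<open>One index controls the polar, the error \<open>1 / Suc q\<close> and the
      starting point of the subsequence.\<close>
    define q where "q = max l m"
    have "t \<in> polar (V q)"
      using m polar_anti_mono[OF decseqD[OF V(3)], of m q] by (auto simp: q_def)
    have "1 / Suc q \<le> 1 / Suc l" by (simp add: q_def field_simps)
    with l have q: "1 / Suc q < e" by simp
    \<comment> \<open>With the same condition at even and odd positions, the alternating subsequence
      is simply a late subsequence of large values.\<close>
    obtain g :: "nat \<Rightarrow> nat" where g: "strict_mono g" "q \<le> g 0" "\<And>k. t (a (M (g k))) - t x \<ge> e"
      using alternating_subsequence[OF inf inf, of q] by auto
    have "t (a ((M \<circ> g) k)) - t x \<ge> 1 / Suc q" for k
      using g(3)[of k] q by simp
    with S(2)[OF M[OF g(1,2)] \<open>t \<in> polar (V q)\<close>] show False by blast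
  qed
  have "limitin weak_topology (\<lambda>k. a (M k)) x sequentially"
  proof (rule limitin_weak_topologyI)
    fix f :: "'a \<Rightarrow> real" assume f: "f \<in> topological_dual"
    \<comment> \<open>The strategies bound values only from above; the lower bound comes from the
      negative functional.\<close>
    have "(\<lambda>x. - f x) \<in> topological_dual"
      using f by (auto simp: topological_dual_def linear_compose_neg intro: continuous_on_minus)
    then have "\<forall>\<^sub>F k in sequentially. f x - f (a (M k)) < e" if "0 < e" for e
      using upper[of "\<lambda>x. - f x" e] that by simp
    then show "(\<lambda>k. f (a (M k))) \<longlonglongrightarrow> f x"
      using upper[OF f] by (intro tendstoI) (auto simp: dist_real_def abs_less_iff intro: eventually_conj)
  qed
  moreover have "range (\<lambda>k. a (M k)) \<subseteq> A" using a(1) by auto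
  ultimately show ?thesis by blast
qed

theorem lemma3p6:
  fixes C :: "'a::locally_convex_space set"
  assumes "metrizable_space (euclidean :: 'a topology)"
    and "separable_space (top_of_set C)"
    and "tvs_bounded C"
    and "\<nexists>x :: nat \<Rightarrow> 'a. range x \<subseteq> C \<and> l1_sequence x"
  shows "frechet_urysohn_space
           (subtopology weak_topology
              (weak_topology closure_of {x - y | x y. x \<in> C \<and> y \<in> C}))"
  unfolding frechet_urysohn_space_def
proof (intro allI impI, elim conjE)
  let ?D = "weak_topology closure_of {x - y | x y. x \<in> C \<and> y \<in> C}"
  fix A x
  assume "A \<subseteq> topspace (subtopology weak_topology ?D)"
    and x: "x \<in> subtopology weak_topology ?D closure_of A"
  then have A: "A \<subseteq> ?D" by simp
  from x A have "x \<in> ?D" "x \<in> weak_topology closure_of A"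
    by (auto simp: closure_of_subtopology Int_absorb1)
  with weak_closure_differences_sequential[OF assms(1,3,4) A] obtain \<xi> :: "nat \<Rightarrow> 'a" where
    "range \<xi> \<subseteq> A" "limitin weak_topology \<xi> x sequentially" by blast
  with A \<open>x \<in> ?D\<close> show "\<exists>\<xi>. range \<xi> \<subseteq> A \<and> limitin (subtopology weak_topology ?D) \<xi> x sequentially"
    by (intro exI[of _ \<xi>]) (auto simp: limitin_subtopology intro!: always_eventually)
qed

end
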